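(* Let $H$ be an infinite dimensional complex Hilbert space and let $T \in \overline{\mathcal{AN}(H)}$ be normal. Let $T = W|T|$ be the polar decomposition of $T$. Then $T = \alpha W - K_1 + K_2$, where $\alpha \geq 0$, $K_1, K_2$ are normal compact operators on $H$, $K_1K_2 = 0$ and $K^*_1 K_1 \leq \alpha^2 I$.
   Context: $\mathcal{B}(H)$ is the space of bounded linear operators on $H$ with the operator norm. An operator is norm attaining if its norm is attained at some unit vector of its domain. $T\in\mathcal{B}(H)$ is absolutely norm attaining (an $\mathcal{AN}$-operator) if for every nonzero closed subspace $M$ of $H$ the restriction $T|_M:M\to H$ is norm attaining. $\mathcal{AN}(H)$ is the set of such operators, and $\overline{\mathcal{AN}(H)}$ its closure in the operator norm. $T$ is normal if $T^*T=TT^*$. For self-adjoint $T_1,T_2$, $T_1\le T_2$ means $T_2-T_1$ is positive. $|T|=(T^*T)^{1/2}$, and the polar decomposition of $T$ is $T=W|T|$ with $W$ the unique partial isometry satisfying $T=W|T|$ and $N(W)=N(T)$ ($N(\cdot)$ is the null space). *)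

theory Defs
  imports "HOL-Analysis.Analysis"
begin

section \<open>Complex Hilbert spaces\<close>

text \<open>
  A complex inner product space is presented on top of its underlying real inner product
  space, whose inner product is the real part of the complex one. Positive definiteness of
  \<open>cinner\<close> and \<open>norm x = sqrt (cinner x x)\<close> then come from \<open>real_inner\<close>. The complex inner
  product is linear in its first argument.
\<close>

class complex_inner = real_inner +
  fixes scaleC :: "complex \<Rightarrow> 'a \<Rightarrow> 'a" (infixr "*\<^sub>C" 75)
    and cinner :: "'a \<Rightarrow> 'a \<Rightarrow> complex"
  assumes scaleC_add_right: "a *\<^sub>C (x + y) = a *\<^sub>C x + a *\<^sub>C y"
    and scaleC_add_left: "(a + b) *\<^sub>C x = a *\<^sub>C x + b *\<^sub>C x"
    and scaleC_scaleC: "a *\<^sub>C (b *\<^sub>C x) = (a * b) *\<^sub>C x"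
    and scaleC_of_real: "complex_of_real r *\<^sub>C x = r *\<^sub>R x"
    and cinner_commute: "cinner x y = cnj (cinner y x)"
    and cinner_add_left: "cinner (x + y) z = cinner x z + cinner y z"
    and cinner_scaleC_left: "cinner (a *\<^sub>C x) y = a * cinner x y"
    and Re_cinner: "Re (cinner x y) = inner x y"

class chilbert_space = complex_inner + complete_space

instantiation complex :: chilbert_space
begin

definition scaleC_complex :: "complex \<Rightarrow> complex \<Rightarrow> complex"
  where "scaleC_complex a x = a * x"

definition cinner_complex :: "complex \<Rightarrow> complex \<Rightarrow> complex"
  where "cinner_complex x y = x * cnj y"

instance
  by standard
    (simp_all add: scaleC_complex_def cinner_complex_def inner_complex_def scaleR_conv_of_real
      algebra_simps)

end

global_interpretation complex_vector: vector_space "scaleC :: complex \<Rightarrow> 'a \<Rightarrow> 'a::complex_inner"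
  defines csubspace = complex_vector.subspace
    and cspan = complex_vector.span
proof
  fix x :: 'a
  show "1 *\<^sub>C x = x"
    using scaleC_of_real[of 1 x] by simp
qed (simp_all add: scaleC_add_right scaleC_add_left scaleC_scaleC)

definition infinite_dimensional :: "'a::complex_inner itself \<Rightarrow> bool"
  where "infinite_dimensional _ \<longleftrightarrow> \<not> (\<exists>B::'a set. finite B \<and> cspan B = UNIV)"


section \<open>Bounded operators\<close>

text \<open>
  \<open>'a \<Rightarrow>\<^sub>L 'a\<close> is the library's type of bounded \<^emph>\<open>real\<close>-linear operators, with the operator norm.
  The space of bounded operators on a complex Hilbert space is its closed subset \<open>BH\<close>, so
  closures of subsets of \<open>BH\<close> may be formed in \<open>'a \<Rightarrow>\<^sub>L 'a\<close>.
\<close>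

definition BH :: "('a::chilbert_space \<Rightarrow>\<^sub>L 'a) set"
  where "BH = {T. \<forall>a x. blinfun_apply T (a *\<^sub>C x) = a *\<^sub>C blinfun_apply T x}"

definition null_space :: "('a::chilbert_space \<Rightarrow>\<^sub>L 'a) \<Rightarrow> 'a set"
  where "null_space T = {x. blinfun_apply T x = 0}"

text \<open>
  The operator norm of the restriction of \<open>T\<close> to a subspace \<open>M\<close>, in the form of the
  library's \<open>onorm\<close>, which is the case \<open>M = UNIV\<close>.
\<close>

definition restr_norm :: "('a::chilbert_space \<Rightarrow>\<^sub>L 'a) \<Rightarrow> 'a set \<Rightarrow> real"
  where "restr_norm T M = (SUP x\<in>M. norm (blinfun_apply T x) / norm x)"

definition norm_attaining_on :: "('a::chilbert_space \<Rightarrow>\<^sub>L 'a) \<Rightarrow> 'a set \<Rightarrow> bool"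
  where "norm_attaining_on T M \<longleftrightarrow>
    (\<exists>x\<in>M. norm x = 1 \<and> norm (blinfun_apply T x) = restr_norm T M)"

definition AN :: "('a::chilbert_space \<Rightarrow>\<^sub>L 'a) set"
  where "AN = {T \<in> BH. \<forall>M. csubspace M \<and> closed M \<and> M \<noteq> {0} \<longrightarrow> norm_attaining_on T M}"

text \<open>For \<open>T \<in> BH\<close> the adjoint exists uniquely (Riesz) and again lies in \<open>BH\<close>.\<close>

definition adj :: "('a::chilbert_space \<Rightarrow>\<^sub>L 'a) \<Rightarrow> 'a \<Rightarrow>\<^sub>L 'a"
  where "adj T = (THE S. \<forall>x y. cinner (blinfun_apply T x) y = cinner x (blinfun_apply S y))"

definition normal_op :: "('a::chilbert_space \<Rightarrow>\<^sub>L 'a) \<Rightarrow> bool"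
  where "normal_op T \<longleftrightarrow> T \<in> BH \<and> adj T o\<^sub>L T = T o\<^sub>L adj T"

definition selfadjoint_op :: "('a::chilbert_space \<Rightarrow>\<^sub>L 'a) \<Rightarrow> bool"
  where "selfadjoint_op T \<longleftrightarrow> T \<in> BH \<and> adj T = T"

definition positive_op :: "('a::chilbert_space \<Rightarrow>\<^sub>L 'a) \<Rightarrow> bool"
  where "positive_op T \<longleftrightarrow> selfadjoint_op T \<and> (\<forall>x. 0 \<le> Re (cinner (blinfun_apply T x) x))"

definition op_le :: "('a::chilbert_space \<Rightarrow>\<^sub>L 'a) \<Rightarrow> ('a \<Rightarrow>\<^sub>L 'a) \<Rightarrow> bool"
  where "op_le S T \<longleftrightarrow> selfadjoint_op S \<and> selfadjoint_op T \<and> positive_op (T - S)"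

definition abs_op :: "('a::chilbert_space \<Rightarrow>\<^sub>L 'a) \<Rightarrow> 'a \<Rightarrow>\<^sub>L 'a"
  where "abs_op T = (THE P. positive_op P \<and> P o\<^sub>L P = adj T o\<^sub>L T)"

definition compact_op :: "('a::chilbert_space \<Rightarrow>\<^sub>L 'a) \<Rightarrow> bool"
  where "compact_op T \<longleftrightarrow> T \<in> BH \<and> (\<forall>S. bounded S \<longrightarrow> compact (closure (blinfun_apply T ` S)))"

definition partial_isometry :: "('a::chilbert_space \<Rightarrow>\<^sub>L 'a) \<Rightarrow> bool"
  where "partial_isometry W \<longleftrightarrow> W \<in> BH \<and>
    (\<forall>x. (\<forall>y\<in>null_space W. cinner x y = 0) \<longrightarrow> norm (blinfun_apply W x) = norm x)"

definition polar_decomposition :: "('a::chilbert_space \<Rightarrow>\<^sub>L 'a) \<Rightarrow> ('a \<Rightarrow>\<^sub>L 'a) \<Rightarrow> bool"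
  where "polar_decomposition T W \<longleftrightarrow>
    partial_isometry W \<and> T = W o\<^sub>L abs_op T \<and> null_space W = null_space T"

end

theory Submission
  imports Defs
begin

text \<open>
  If \<open>\<parallel>T x\<parallel>\<^sup>2\<close> oscillated by a fixed amount over the unit vectors of every subspace of finite
  codimension, one could choose orthonormal vectors \<open>g\<^sub>n\<close> with orthogonal images \<open>T g\<^sub>n\<close> and strictly
  increasing \<open>\<parallel>T g\<^sub>n\<parallel>\<close>, and \<open>T\<close> would not attain its norm on their closed span. So for an
  \<open>\<A>\<N>\<close>-operator the oscillation tends to zero. This condition survives limits in operator norm and
  says that \<open>T\<^sup>*T - \<alpha>\<^sup>2 I\<close> is compact for some \<open>\<alpha> \<ge> 0\<close>; hence \<open>K = |T| - \<alpha> I\<close> is compact. If \<open>N\<close> and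
  \<open>P\<close> are the negative and positive parts of \<open>K\<close>, then \<open>K\<^sub>1 = W N\<close> and \<open>K\<^sub>2 = W P\<close> have the required
  properties, because for normal \<open>T\<close> the partial isometry \<open>W\<close> is normal and commutes with \<open>|T|\<close>.

  Subspaces of finite codimension are written \<open>F\<^sup>\<bottom>\<close> with \<open>F\<close> finite, for the real inner product.
\<close>

section \<open>Adjoints and square roots\<close>

instance chilbert_space \<subseteq> banach ..

text \<open>First-variation test: near \<open>t = 0\<close> the linear term dominates, so a nonzero
  \<open>a\<close> would give a negative value on one side of zero. It turns minimality or
  maximality of a quadratic expression into a linear equation.\<close>

lemma quadratic_nonneg_imp_linear_coeff_0:
  fixes a b :: real
  assumes "\<And>t. 0 \<le> a * t + b * t\<^sup>2"
  shows "a = 0"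
proof (rule ccontr)
  assume "a \<noteq> 0"
  \<comment> \<open>Positive and strictly above \<open>b\<close> whatever the sign of
    \<open>b\<close>; the test point \<open>- a / c\<close> then gives a negative value.\<close>
  define c where "c = \<bar>b\<bar> + 1"
  have c: "c > 0" "b < c" by (auto simp: c_def)
  have "0 \<le> a * (- a / c) + b * (- a / c)\<^sup>2" by (rule assms)
  also have "\<dots> = (a\<^sup>2 / c) * (b / c - 1)"
    using c by (simp add: power2_eq_square field_simps)
  also have "\<dots> < 0"
    using c \<open>a \<noteq> 0\<close> by (intro mult_pos_neg) (auto simp: field_simps)
  finally show False by simp
qed

text \<open>The representing vector is the minimizer of \<open>J\<close>. The parallelogram law
  makes every minimizing sequence Cauchy, completeness gives the minimizer, and the first variation
  of \<open>J\<close> there is the required equation.\<close>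

lemma riesz_representation:
  fixes f :: "'a::{real_inner,banach} \<Rightarrow> real"
  assumes "bounded_linear f"
  shows "\<exists>y. \<forall>x. f x = inner x y"
proof -
  interpret f: bounded_linear f by fact
  obtain c where c: "\<And>x. norm (f x) \<le> norm x * c" using f.bounded by blast
  define J where "J x = (norm x)\<^sup>2 / 2 - f x" for x
  have J_ge: "- (c\<^sup>2 / 2) \<le> J x" for x
  proof -
    have "f x \<le> norm x * c" using c[of x] by simp
    moreover have "0 \<le> (norm x - c)\<^sup>2" by simp
    ultimately show ?thesis unfolding J_def by (simp add: power2_diff)
  qed
  define m where "m = Inf (range J)"
  have bdd: "bdd_below (range J)" using J_ge by (auto simp: bdd_below_def)
  have m_le: "m \<le> J x" for x unfolding m_def using bdd by (intro cInf_lower) auto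
  have "\<exists>x. J x < m + 1 / real (Suc n)" for n
    using cInf_less_iff[OF _ bdd, of "m + 1 / real (Suc n)"] by (auto simp: m_def)
  then obtain X where X: "\<And>n. J (X n) < m + 1 / real (Suc n)" by metis
  have par: "(norm (x - y))\<^sup>2 = 4 * (J x + J y - 2 * J ((1/2) *\<^sub>R (x + y)))" for x y
    by (simp add: J_def f.add f.scaleR power2_norm_eq_inner inner_add inner_diff inner_commute
        power_mult_distrib power_divide algebra_simps)
  \<comment> \<open>Two values of \<open>J\<close> within \<open>d / 8\<close> of the infimum, and a
    midpoint value at least the infimum, make the right side of \<open>par\<close> less than
    \<open>d\<close>.\<close>
  have gen: "4 * (a + b - 2 * c) < d" if "a < m + d / 8" "b < m + d / 8" "m \<le> c" for a b c d
    using that by (simp add: field_simps)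
  have "Cauchy X"
  proof (rule CauchyI)
    fix e :: real assume "e > 0"
    obtain N where N: "1 / real (Suc N) < e\<^sup>2 / 8"
      using nat_approx_posE[of "e\<^sup>2 / 8"] \<open>e > 0\<close> by auto
    show "\<exists>M. \<forall>k\<ge>M. \<forall>n\<ge>M. norm (X k - X n) < e"
    proof (intro exI[of _ N] allI impI)
      fix k n assume "N \<le> k" "N \<le> n"
      then have "1 / real (Suc k) \<le> 1 / real (Suc N)" "1 / real (Suc n) \<le> 1 / real (Suc N)"
        by (auto intro!: divide_left_mono)
      then have "J (X k) < m + e\<^sup>2 / 8" "J (X n) < m + e\<^sup>2 / 8"
        using X[of k] X[of n] N by linarith+
      then have "4 * (J (X k) + J (X n) - 2 * J ((1/2) *\<^sub>R (X k + X n))) < e\<^sup>2"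
        using gen m_le by blast
      then have "(norm (X k - X n))\<^sup>2 < e\<^sup>2" unfolding par .
      then show "norm (X k - X n) < e"
        using \<open>e > 0\<close> by (intro power2_less_imp_less[of _ e]) auto
    qed
  qed
  then obtain x where x: "X \<longlonglongrightarrow> x" using Cauchy_convergent convergent_def by blast
  have "(\<lambda>n. J (X n)) \<longlonglongrightarrow> J x"
    unfolding J_def by (intro tendsto_intros x f.tendsto) simp
  moreover have "(\<lambda>n. m + 1 / real (Suc n)) \<longlonglongrightarrow> m + 0"
    by (intro tendsto_intros LIMSEQ_Suc[OF lim_1_over_n])
  ultimately have "J x \<le> m"
    using X by (intro LIMSEQ_le[of "\<lambda>n. J (X n)" _ "\<lambda>n. m + 1 / real (Suc n)"]) (auto intro: less_imp_le)
  then have min: "J x \<le> J z" for z using m_le[of z] by linarith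
  have "f z = inner z x" for z
  proof -
    have "0 \<le> (inner z x - f z) * t + ((norm z)\<^sup>2 / 2) * t\<^sup>2" for t
    proof -
      have "(norm (x + t *\<^sub>R z))\<^sup>2 = (norm x)\<^sup>2 + 2 * t * inner z x + t\<^sup>2 * (norm z)\<^sup>2"
        by (simp add: power2_norm_eq_inner inner_add inner_commute power2_eq_square[of t] algebra_simps)
      then show ?thesis
        using min[of "x + t *\<^sub>R z"] by (simp add: J_def f.add f.scaleR algebra_simps)
    qed
    from quadratic_nonneg_imp_linear_coeff_0[OF this] show ?thesis by simp
  qed
  then show ?thesis by blast
qed

text \<open>A relation for the real inner product, so that adjoints can be handled without the
  definite description in \<open>adj\<close> and before complex linearity is known. For operators in
  \<open>BH\<close> it is tied to \<open>adj\<close> by \<open>cinner_adjoint_of\<close> and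
  \<open>adj_eqI\<close>.\<close>

definition adjoint_of :: "('a::real_inner \<Rightarrow>\<^sub>L 'a) \<Rightarrow> ('a \<Rightarrow>\<^sub>L 'a) \<Rightarrow> bool"
  where "adjoint_of T S \<longleftrightarrow> (\<forall>x y. inner (T x) y = inner x (S y))"

lemma adjoint_ofD: "adjoint_of T S \<Longrightarrow> inner (blinfun_apply T x) y = inner x (blinfun_apply S y)"
  by (simp add: adjoint_of_def)

lemma adjoint_of_sym: "adjoint_of T S \<Longrightarrow> adjoint_of S T"
  by (simp add: adjoint_of_def) (metis inner_commute)

lemma adjoint_of_unique: "adjoint_of T S \<Longrightarrow> adjoint_of T S' \<Longrightarrow> S = S'"
  unfolding adjoint_of_def by (metis blinfun_eqI vector_eq_rdot inner_commute)

lemma adjoint_of_compose: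
  "adjoint_of T T' \<Longrightarrow> adjoint_of S S' \<Longrightarrow> adjoint_of (T o\<^sub>L S) (S' o\<^sub>L T')"
  by (simp add: adjoint_of_def)

lemma adjoint_of_add: "adjoint_of T T' \<Longrightarrow> adjoint_of S S' \<Longrightarrow> adjoint_of (T + S) (T' + S')"
  by (simp add: adjoint_of_def blinfun.bilinear_simps inner_add)

lemma adjoint_of_diff: "adjoint_of T T' \<Longrightarrow> adjoint_of S S' \<Longrightarrow> adjoint_of (T - S) (T' - S')"
  by (simp add: adjoint_of_def blinfun.bilinear_simps inner_diff)

lemma adjoint_of_scaleR: "adjoint_of T T' \<Longrightarrow> adjoint_of (c *\<^sub>R T) (c *\<^sub>R T')"
  by (simp add: adjoint_of_def blinfun.bilinear_simps)

lemma adjoint_of_id: "adjoint_of id_blinfun id_blinfun"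
  by (simp add: adjoint_of_def)

lemmas adjoint_of_intros =
  adjoint_of_compose adjoint_of_add adjoint_of_diff adjoint_of_scaleR adjoint_of_id

lemma norm_eq_of_adjoint:
  assumes "adjoint_of T T'"
  shows "(norm (blinfun_apply T x))\<^sup>2 = inner ((T' o\<^sub>L T) x) x"
  using adjoint_ofD[OF assms, of x "T x"] by (simp add: power2_norm_eq_inner inner_commute)

lemma adjoint_comp_self_eq_0:
  assumes "adjoint_of T T'" "T' o\<^sub>L T = 0"
  shows "T = 0"
proof (rule blinfun_eqI)
  fix x
  show "blinfun_apply T x = blinfun_apply 0 x"
    using norm_eq_of_adjoint[OF assms(1), of x] assms(2) by simp
qed

lemma adjoint_of_exists:
  fixes T :: "'a::{real_inner,banach} \<Rightarrow>\<^sub>L 'a"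
  shows "\<exists>S. adjoint_of T S"
proof -
  have "\<exists>z. \<forall>x. inner (T x) y = inner x z" for y
    by (rule riesz_representation) (intro bounded_linear_intros)
  then obtain S where S: "\<And>x y. inner (T x) y = inner x (S y)" by metis
  have "bounded_linear S"
  proof (rule bounded_linear_intro)
    show "S (x + y) = S x + S y" for x y
      by (metis (no_types, lifting) S inner_add_right vector_eq_ldot)
    show "S (r *\<^sub>R x) = r *\<^sub>R S x" for r x
      by (metis (no_types, lifting) S inner_scaleR_right vector_eq_ldot)
    show "norm (S x) \<le> norm x * norm T" for x
    proof -
      have "(norm (S x))\<^sup>2 = inner (T (S x)) x" by (simp add: S power2_norm_eq_inner)
      also have "\<dots> \<le> norm (T (S x)) * norm x" by (rule norm_cauchy_schwarz)
      also have "\<dots> \<le> norm T * norm (S x) * norm x" by (intro mult_right_mono norm_blinfun) auto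
      finally have *: "norm (S x) * norm (S x) \<le> (norm x * norm T) * norm (S x)"
        by (simp add: power2_eq_square algebra_simps)
      show ?thesis
      proof (cases "norm (S x) = 0")
        case False
        then have "0 < norm (S x)" by simp
        with * show ?thesis by (rule mult_right_le_imp_le)
      qed auto
    qed
  qed
  then have "adjoint_of T (Blinfun S)"
    by (simp add: adjoint_of_def S bounded_linear_Blinfun_apply)
  then show ?thesis by blast
qed

section \<open>Positive square roots\<close>

lemma positive_form_zero:
  assumes "adjoint_of B B" "\<And>x. 0 \<le> inner (blinfun_apply B x) x" "inner (blinfun_apply B y) y = 0"
  shows "blinfun_apply B y = 0"
proof -
  \<comment> \<open>The form of \<open>B\<close> has a minimum at \<open>y\<close>. Varying in the
    direction \<open>B y\<close> makes the linear coefficient twice the squared norm of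
    \<open>B y\<close>.\<close>
  have "0 \<le> (2 * inner (B y) (B y)) * t + inner (B (B y)) (B y) * t\<^sup>2" for t
    using assms(2)[of "y + t *\<^sub>R B y"] assms(3) adjoint_ofD[OF assms(1), of "B y" y]
    by (simp add: blinfun.bilinear_simps inner_add inner_commute power2_eq_square algebra_simps)
  from quadratic_nonneg_imp_linear_coeff_0[OF this] show ?thesis by simp
qed

text \<open>The real iteration is the operator iteration at \<open>X = 1\<close>. It majorizes the latter when
  \<open>norm X \<le> 1\<close>, which yields convergence in norm although \<open>norm X = 1\<close> is allowed.\<close>

primrec sqrt_iter :: "('a::real_normed_vector \<Rightarrow>\<^sub>L 'a) \<Rightarrow> nat \<Rightarrow> 'a \<Rightarrow>\<^sub>L 'a" where
  "sqrt_iter X 0 = 0"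
| "sqrt_iter X (Suc n) = (1/2) *\<^sub>R (X + (sqrt_iter X n o\<^sub>L sqrt_iter X n))"

primrec sqrt_iter_real :: "nat \<Rightarrow> real" where
  "sqrt_iter_real 0 = 0"
| "sqrt_iter_real (Suc n) = (1 + (sqrt_iter_real n)\<^sup>2) / 2"

lemma sqrt_iter_real_bounds: "0 \<le> sqrt_iter_real n" "sqrt_iter_real n \<le> 1"
  by (induction n) (auto simp: power_le_one_iff)

lemma sqrt_iter_real_mono: "sqrt_iter_real n \<le> sqrt_iter_real (Suc n)"
  using zero_le_power2[of "sqrt_iter_real n - 1"] by (simp add: power2_diff)

lemmas blinfun_compose_simps =
  bounded_bilinear.add_left[OF bounded_bilinear_blinfun_compose]
  bounded_bilinear.add_right[OF bounded_bilinear_blinfun_compose]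
  bounded_bilinear.diff_left[OF bounded_bilinear_blinfun_compose]
  bounded_bilinear.diff_right[OF bounded_bilinear_blinfun_compose]
  bounded_bilinear.scaleR_left[OF bounded_bilinear_blinfun_compose]
  bounded_bilinear.scaleR_right[OF bounded_bilinear_blinfun_compose]
  bounded_bilinear.zero_left[OF bounded_bilinear_blinfun_compose]
  bounded_bilinear.zero_right[OF bounded_bilinear_blinfun_compose]

lemma blinfun_compose_id [simp]:
  fixes T :: "'a::real_normed_vector \<Rightarrow>\<^sub>L 'b::real_normed_vector"
  shows "T o\<^sub>L id_blinfun = T" "id_blinfun o\<^sub>L T = T"
  by (auto intro: blinfun_eqI)

lemma blinfun_composeD: "T o\<^sub>L S = U o\<^sub>L V \<Longrightarrow> blinfun_apply T (S x) = U (V x)"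
  by (metis blinfun_apply_blinfun_compose)

lemma sqrt_iter_commute:
  assumes "S o\<^sub>L X = X o\<^sub>L S"
  shows "S o\<^sub>L sqrt_iter X n = sqrt_iter X n o\<^sub>L S"
proof (induction n)
  case (Suc n)
  have IH: "S (sqrt_iter X n x) = sqrt_iter X n (S x)" for x
    using arg_cong[OF Suc, of "\<lambda>U. blinfun_apply U x"] by simp
  have "S (X x) = X (S x)" for x using arg_cong[OF assms, of "\<lambda>U. blinfun_apply U x"] by simp
  with IH show ?case by (intro blinfun_eqI) (simp add: blinfun.bilinear_simps)
qed (auto intro: blinfun_eqI)

lemma sqrt_iter_norm:
  assumes "norm X \<le> 1"
  shows "norm (sqrt_iter X n) \<le> sqrt_iter_real n"
proof (induction n)
  case (Suc n)
  have "norm (X + (sqrt_iter X n o\<^sub>L sqrt_iter X n)) \<le>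
      norm X + norm (sqrt_iter X n) * norm (sqrt_iter X n)"
    by (rule order_trans[OF norm_triangle_ineq add_left_mono[OF norm_blinfun_compose]])
  also have "\<dots> \<le> 1 + sqrt_iter_real n * sqrt_iter_real n"
    using assms Suc by (intro add_mono mult_mono sqrt_iter_real_bounds) auto
  finally show ?case by (simp add: power2_eq_square)
qed auto

text \<open>Consecutive iterates commute, so the difference of their squares factors as (a - b)(a +
  b). The real iteration factors in the same way, and the induction compares the two products factor
  by factor.\<close>

lemma sqrt_iter_step:
  assumes "norm X \<le> 1"
  shows "norm (sqrt_iter X (Suc n) - sqrt_iter X n) \<le> sqrt_iter_real (Suc n) - sqrt_iter_real n"
proof (induction n)
  case 0
  show ?case using assms by simp
next
  case (Suc n)
  let ?a = "sqrt_iter X (Suc n)" and ?b = "sqrt_iter X n"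
  let ?s = "sqrt_iter_real (Suc n)" and ?t = "sqrt_iter_real n"
  have "?a o\<^sub>L ?b = ?b o\<^sub>L ?a"
    by (intro sqrt_iter_commute sqrt_iter_commute[symmetric]) auto
  then have c: "?a (?b x) = ?b (?a x)" for x
    by (metis blinfun_apply_blinfun_compose)
  have "sqrt_iter X (Suc (Suc n)) - ?a = (1/2) *\<^sub>R ((?a - ?b) o\<^sub>L (?a + ?b))"
  proof -
    have "sqrt_iter X (Suc (Suc n)) - ?a = (1/2) *\<^sub>R ((?a o\<^sub>L ?a) - (?b o\<^sub>L ?b))"
    proof -
      have "?a = (1/2) *\<^sub>R (X + (?b o\<^sub>L ?b))"
        "sqrt_iter X (Suc (Suc n)) = (1/2) *\<^sub>R (X + (?a o\<^sub>L ?a))"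
        by (rule sqrt_iter.simps)+
      then have "sqrt_iter X (Suc (Suc n)) - ?a =
          (1/2) *\<^sub>R (X + (?a o\<^sub>L ?a)) - (1/2) *\<^sub>R (X + (?b o\<^sub>L ?b))" by (rule arg_cong2)
      then show ?thesis by (simp only: scaleR_diff_right[symmetric] add_diff_cancel_left)
    qed
    also have "(?a o\<^sub>L ?a) - (?b o\<^sub>L ?b) = (?a - ?b) o\<^sub>L (?a + ?b)"
      using c by (intro blinfun_eqI) (simp add: blinfun.bilinear_simps del: sqrt_iter.simps)
    finally show ?thesis .
  qed
  also have "norm \<dots> \<le> (norm (?a - ?b) * norm (?a + ?b)) / 2"
    using norm_blinfun_compose[of "?a - ?b" "?a + ?b"] by (simp del: sqrt_iter.simps)
  also have "\<dots> \<le> ((?s - ?t) * (?s + ?t)) / 2"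
    using Suc sqrt_iter_norm[OF assms, of n] sqrt_iter_norm[OF assms, of "Suc n"]
      sqrt_iter_real_mono[of n]
    by (intro divide_right_mono mult_mono)
       (auto simp del: sqrt_iter.simps sqrt_iter_real.simps intro: order_trans[OF norm_triangle_ineq])
  also have "\<dots> = sqrt_iter_real (Suc (Suc n)) - ?s"
  proof -
    have "?s = (1 + ?t\<^sup>2) / 2" "sqrt_iter_real (Suc (Suc n)) = (1 + ?s\<^sup>2) / 2"
      by (rule sqrt_iter_real.simps)+
    then have "sqrt_iter_real (Suc (Suc n)) - ?s = (1 + ?s\<^sup>2) / 2 - (1 + ?t\<^sup>2) / 2"
      by (rule arg_cong2)
    also have "\<dots> = ((?s - ?t) * (?s + ?t)) / 2"
      unfolding diff_divide_distrib[symmetric] by (simp only: power2_eq_square) algebra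
    finally show ?thesis by simp
  qed
  finally show ?case .
qed

text \<open>Telescoping bounds the increments by those of an increasing real sequence that stays
  below 1; the convergence of that sequence suffices, and no rate is involved.\<close>

lemma sqrt_iter_Cauchy:
  assumes "norm X \<le> 1"
  shows "Cauchy (sqrt_iter X)"
proof -
  have mono: "incseq sqrt_iter_real" by (intro incseq_SucI sqrt_iter_real_mono)
  have le: "norm (sqrt_iter X (n + k) - sqrt_iter X n) \<le> sqrt_iter_real (n + k) - sqrt_iter_real n"
    for n k
  proof (induction k)
    case (Suc k)
    show ?case
      using norm_triangle_ineq[of "sqrt_iter X (Suc (n + k)) - sqrt_iter X (n + k)"
          "sqrt_iter X (n + k) - sqrt_iter X n"] sqrt_iter_step[OF assms, of "n + k"] Suc
      by (simp del: sqrt_iter.simps sqrt_iter_real.simps)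
  qed auto
  have "Cauchy sqrt_iter_real"
    using mono sqrt_iter_real_bounds
    by (intro convergent_Cauchy Bseq_mono_convergent BseqI'[where K = 1])
       (auto simp: incseq_def)
  show ?thesis
  proof (rule CauchyI)
    fix e :: real assume "e > 0"
    then obtain M where M: "\<And>m n. m \<ge> M \<Longrightarrow> n \<ge> M \<Longrightarrow> norm (sqrt_iter_real m - sqrt_iter_real n) < e"
      using CauchyD[OF \<open>Cauchy sqrt_iter_real\<close>] by blast
    have *: "norm (sqrt_iter X m - sqrt_iter X n) < e" if "M \<le> n" "n \<le> m" for m n
      using le[of n "m - n"] M[of m n] that by auto
    show "\<exists>M. \<forall>m\<ge>M. \<forall>n\<ge>M. norm (sqrt_iter X m - sqrt_iter X n) < e"
      using * by (metis norm_minus_commute nle_le)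
  qed
qed

lemma commute_limit:
  fixes S :: "'a::real_normed_vector \<Rightarrow>\<^sub>L 'a"
  assumes "Y \<longlonglongrightarrow> y" "\<And>n. S o\<^sub>L Y n = Y n o\<^sub>L S"
  shows "S o\<^sub>L y = y o\<^sub>L S"
proof (rule LIMSEQ_unique)
  show "(\<lambda>n. S o\<^sub>L Y n) \<longlonglongrightarrow> (S o\<^sub>L y)"
    by (intro bounded_bilinear.tendsto[OF bounded_bilinear_blinfun_compose] tendsto_const assms)
  show "(\<lambda>n. S o\<^sub>L Y n) \<longlonglongrightarrow> (y o\<^sub>L S)"
    unfolding assms(2)
    by (intro bounded_bilinear.tendsto[OF bounded_bilinear_blinfun_compose] tendsto_const assms)
qed

lemma adjoint_of_limit:
  assumes "Y \<longlonglongrightarrow> y" "\<And>n. adjoint_of (Y n) (Y n)"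
  shows "adjoint_of y y"
  unfolding adjoint_of_def
proof (intro allI)
  fix u v
  have "(\<lambda>n. inner (Y n u) v) \<longlonglongrightarrow> inner (y u) v"
    by (intro tendsto_intros assms(1))
  moreover have "(\<lambda>n. inner (Y n u) v) \<longlonglongrightarrow> inner u (y v)"
    unfolding adjoint_ofD[OF assms(2)] by (intro tendsto_intros assms(1))
  ultimately show "inner (y u) v = inner u (y v)" by (rule LIMSEQ_unique)
qed

text \<open>Positivity refers to the real inner product. Complex linearity of a root is recovered in
  \<open>abs_op_properties\<close> from its commutation with scalar multiplications.\<close>

definition is_sqrt :: "('a::real_inner \<Rightarrow>\<^sub>L 'a) \<Rightarrow> ('a \<Rightarrow>\<^sub>L 'a) \<Rightarrow> bool"
  where "is_sqrt B A \<longleftrightarrow> adjoint_of B B \<and> (\<forall>x. 0 \<le> inner (B x) x) \<and> B o\<^sub>L B = A"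

text \<open>With A = T'T and X = I - A, the limit \<open>y\<close> of the iteration satisfies 2y = X
  + y^2, that is, (I - y)^2 = A. Whatever commutes with A commutes with X, with every iterate, and
  so with the limit.\<close>

lemma contraction_sqrt_exists:
  fixes T :: "'a::{real_inner,banach} \<Rightarrow>\<^sub>L 'a"
  assumes T: "adjoint_of T T'" and "norm T \<le> 1"
  shows "\<exists>B. is_sqrt B (T' o\<^sub>L T) \<and> (\<forall>S. S o\<^sub>L (T' o\<^sub>L T) = (T' o\<^sub>L T) o\<^sub>L S \<longrightarrow> S o\<^sub>L B = B o\<^sub>L S)"
proof -
  define A where "A = T' o\<^sub>L T"
  have A: "adjoint_of A A" unfolding A_def by (intro adjoint_of_compose T adjoint_of_sym[OF T])
  define X where "X = id_blinfun - A"
  have Xadj: "adjoint_of X X" unfolding X_def by (intro adjoint_of_intros A)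
  have T_le: "norm (T x) \<le> norm x" for x
    using norm_blinfun[of T x] assms(2) mult_right_mono[OF assms(2), of "norm x"] by simp
  have T'_le: "norm (T' x) \<le> norm x" for x
  proof (rule ccontr)
    assume "\<not> ?thesis"
    then have l: "norm x < norm (T' x)" by simp
    have "norm (T' x) * norm (T' x) = inner (T (T' x)) x"
      using adjoint_ofD[OF T, of "T' x" x] by (simp flip: power2_norm_eq_inner power2_eq_square)
    also have "\<dots> \<le> norm (T (T' x)) * norm x" by (rule norm_cauchy_schwarz)
    also have "\<dots> \<le> norm (T' x) * norm x" by (intro mult_right_mono T_le) auto
    finally show False
      using l by (smt (verit) mult_le_cancel_left norm_ge_zero)
  qed
  \<comment> \<open>Expanding ||X x||^2 gives ||x||^2 - 2||T x||^2 + ||A x||^2. Since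
    \<open>T'\<close> is a contraction too, ||A x|| is at most ||T x||.\<close>
  have "norm X \<le> 1"
  proof (rule norm_blinfun_bound)
    fix x
    have "(norm (X x))\<^sup>2 = (norm x)\<^sup>2 - 2 * (norm (T x))\<^sup>2 + (norm (A x))\<^sup>2"
      using norm_eq_of_adjoint[OF T, of x]
      by (simp add: X_def A_def power2_norm_eq_inner blinfun.bilinear_simps inner_diff inner_commute)
    moreover have "norm (A x) \<le> norm (T x)" unfolding A_def using T'_le[of "T x"] by simp
    then have "(norm (A x))\<^sup>2 \<le> (norm (T x))\<^sup>2" by (simp add: power_mono)
    ultimately have "(norm (X x))\<^sup>2 \<le> (norm x)\<^sup>2" using zero_le_power2[of "norm (T x)"] by linarith
    then show "norm (X x) \<le> 1 * norm x" using power2_le_imp_le[OF _ norm_ge_zero] by simp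
  qed auto
  from sqrt_iter_Cauchy[OF this] obtain y where y: "sqrt_iter X \<longlonglongrightarrow> y"
    using Cauchy_convergent convergent_def by blast
  have "(\<lambda>n. sqrt_iter X (Suc n)) \<longlonglongrightarrow> (1/2) *\<^sub>R (X + (y o\<^sub>L y))"
    unfolding sqrt_iter.simps
    by (intro tendsto_intros bounded_bilinear.tendsto[OF bounded_bilinear_blinfun_compose] y)
  then have y_eq: "y = (1/2) *\<^sub>R (X + (y o\<^sub>L y))"
    by (rule LIMSEQ_unique[OF LIMSEQ_Suc[OF y]])
  have "norm (sqrt_iter X n) \<le> 1" for n
    using sqrt_iter_norm[OF \<open>norm X \<le> 1\<close>, of n] sqrt_iter_real_bounds(2)[of n] by linarith
  then have y_norm: "norm y \<le> 1"
    by (intro LIMSEQ_le_const2[OF tendsto_norm[OF y]]) auto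
  have "adjoint_of (sqrt_iter X n) (sqrt_iter X n)" for n
  proof (induction n)
    case (Suc n)
    then show ?case
      unfolding sqrt_iter.simps
      by (intro adjoint_of_scaleR adjoint_of_add adjoint_of_compose Xadj)
  qed (simp add: adjoint_of_def)
  then have y_adj: "adjoint_of y y" by (rule adjoint_of_limit[OF y])
  define B where "B = id_blinfun - y"
  have "B o\<^sub>L B = A"
  proof (rule blinfun_eqI)
    fix x
    have "y x = (1/2) *\<^sub>R (X x + y (y x))"
      by (subst y_eq) (simp add: blinfun.bilinear_simps)
    then have "2 *\<^sub>R y x = 2 *\<^sub>R ((1/2) *\<^sub>R (X x + y (y x)))" by (rule arg_cong)
    then have "y x + y x = X x + y (y x)" by (simp only: scaleR_scaleR scaleR_2) simp
    then show "(B o\<^sub>L B) x = A x"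
      by (simp add: B_def X_def blinfun.bilinear_simps algebra_simps)
  qed
  moreover have "adjoint_of B B" unfolding B_def by (intro adjoint_of_intros y_adj)
  moreover have "0 \<le> inner (B x) x" for x
  proof -
    have "inner (y x) x \<le> norm (y x) * norm x" by (rule norm_cauchy_schwarz)
    also have "\<dots> \<le> norm x * norm x"
      using norm_blinfun[of y x] mult_right_mono[OF y_norm, of "norm x"]
      by (intro mult_right_mono) auto
    finally show ?thesis
      by (simp add: B_def blinfun.bilinear_simps inner_diff flip: power2_norm_eq_inner power2_eq_square)
  qed
  moreover have "S o\<^sub>L B = B o\<^sub>L S" if "S o\<^sub>L A = A o\<^sub>L S" for S
  proof -
    have "S o\<^sub>L X = X o\<^sub>L S"
      using that by (simp add: X_def blinfun_compose_simps)
    then have "S o\<^sub>L y = y o\<^sub>L S" by (intro commute_limit[OF y] sqrt_iter_commute)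
    then show ?thesis by (simp add: B_def blinfun_compose_simps)
  qed
  ultimately show ?thesis unfolding is_sqrt_def A_def by blast
qed

lemma sqrt_exists:
  fixes T :: "'a::{real_inner,banach} \<Rightarrow>\<^sub>L 'a"
  assumes T: "adjoint_of T T'"
  shows "\<exists>B. is_sqrt B (T' o\<^sub>L T) \<and> (\<forall>S. S o\<^sub>L (T' o\<^sub>L T) = (T' o\<^sub>L T) o\<^sub>L S \<longrightarrow> S o\<^sub>L B = B o\<^sub>L S)"
proof -
  \<comment> \<open>Scaling reduces to a contraction; adding 1 keeps \<open>c\<close> positive when
    \<open>T\<close> is zero.\<close>
  define c where "c = norm T + 1"
  have c: "c > 0" by (simp add: c_def add_nonneg_pos)
  have n: "norm ((1/c) *\<^sub>R T) \<le> 1" using c by (simp add: c_def)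
  have eq: "((1/c) *\<^sub>R T') o\<^sub>L ((1/c) *\<^sub>R T) = (1/c\<^sup>2) *\<^sub>R (T' o\<^sub>L T)"
    by (intro blinfun_eqI) (simp add: blinfun.bilinear_simps power2_eq_square)
  have comm: "S o\<^sub>L (d *\<^sub>R U) = (d *\<^sub>R U) o\<^sub>L S \<longleftrightarrow> S o\<^sub>L U = U o\<^sub>L S" if "d \<noteq> 0" for S U :: "'a \<Rightarrow>\<^sub>L 'a" and d
    using that by (simp add: blinfun_compose_simps)
  obtain B where B: "is_sqrt B ((1/c\<^sup>2) *\<^sub>R (T' o\<^sub>L T))"
    "\<And>S. S o\<^sub>L (T' o\<^sub>L T) = (T' o\<^sub>L T) o\<^sub>L S \<Longrightarrow> S o\<^sub>L B = B o\<^sub>L S"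
  proof -
    have "1 / c\<^sup>2 \<noteq> 0" using c by simp
    from contraction_sqrt_exists[OF adjoint_of_scaleR[OF T] n]
    show ?thesis unfolding eq comm[OF \<open>1 / c\<^sup>2 \<noteq> 0\<close>] using that by blast
  qed
  have "is_sqrt (c *\<^sub>R B) (T' o\<^sub>L T)"
    unfolding is_sqrt_def
  proof (intro conjI allI)
    show "adjoint_of (c *\<^sub>R B) (c *\<^sub>R B)"
      using B(1)[unfolded is_sqrt_def] by (intro adjoint_of_scaleR) blast
    show "0 \<le> inner ((c *\<^sub>R B) x) x" for x using B(1) c by (simp add: is_sqrt_def blinfun.bilinear_simps)
    have "(c *\<^sub>R B) o\<^sub>L (c *\<^sub>R B) = c\<^sup>2 *\<^sub>R (B o\<^sub>L B)"
      by (simp add: blinfun_compose_simps power2_eq_square)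
    also have "\<dots> = T' o\<^sub>L T" using B(1) c by (simp add: is_sqrt_def)
    finally show "(c *\<^sub>R B) o\<^sub>L (c *\<^sub>R B) = T' o\<^sub>L T" .
  qed
  moreover have "S o\<^sub>L (c *\<^sub>R B) = (c *\<^sub>R B) o\<^sub>L S"
    if "S o\<^sub>L (T' o\<^sub>L T) = (T' o\<^sub>L T) o\<^sub>L S" for S
    using B(2)[OF that] by (simp add: blinfun_compose_simps)
  ultimately show ?thesis by blast
qed

text \<open>For commuting roots, (B + C)(B - C) = 0, so the two nonnegative forms sum to zero at y =
  (B - C)x and both vanish there. Then B y = C y = 0, and ||y||^2 = <x, (B - C) y> = 0.\<close>

lemma sqrt_unique:
  assumes B: "is_sqrt B A" and C: "is_sqrt C A" and "B o\<^sub>L C = C o\<^sub>L B"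
  shows "B = C"
proof (rule blinfun_eqI)
  fix x
  note B' = B[unfolded is_sqrt_def] and C' = C[unfolded is_sqrt_def]
  define y where "y = B x - C x"
  have sq: "B (B z) = C (C z)" for z
    using B' C' by (intro blinfun_composeD) simp
  have c: "B (C z) = C (B z)" for z using assms(3) by (rule blinfun_composeD)
  have "B y + C y = 0" by (simp add: y_def blinfun.bilinear_simps sq c)
  then have "inner (B y) y + inner (C y) y = 0" by (simp flip: inner_add_left)
  then have "inner (B y) y = 0" "inner (C y) y = 0"
    using B'[THEN conjunct2, THEN conjunct1, rule_format, of y]
      C'[THEN conjunct2, THEN conjunct1, rule_format, of y] by linarith+
  then have "B y = 0" "C y = 0" using positive_form_zero B' C' by blast+
  moreover have "inner y y = inner x (B y) - inner x (C y)"
    using adjoint_ofD[of B B x y] adjoint_ofD[of C C x y] B' C'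
    by (simp add: inner_diff_left y_def)
  ultimately show "B x = C x" by (simp add: y_def)
qed


section \<open>Operators modulo subspaces of finite codimension\<close>

lemma orthogonal_comp_inner: "F\<^sup>\<bottom> = {x. \<forall>v\<in>F. inner x v = 0}"
  by (simp add: orthogonal_comp_def orthogonal_def inner_commute)

lemma orthogonal_comp_normalize:
  assumes "x \<in> F\<^sup>\<bottom>" "x \<noteq> 0"
  shows "(1 / norm x) *\<^sub>R x \<in> F\<^sup>\<bottom>" "norm ((1 / norm x) *\<^sub>R x) = 1"
  using assms by (auto simp: orthogonal_comp_inner)

text \<open>Encodes compactness as smallness on subspaces of finite codimension;
  \<open>ess_zero_compact\<close> gives the topological form.\<close>

definition ess_zero :: "('a::real_inner \<Rightarrow>\<^sub>L 'a) \<Rightarrow> bool"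
  where "ess_zero K \<longleftrightarrow>
    (\<forall>e>0. \<exists>F. finite F \<and> (\<forall>x\<in>F\<^sup>\<bottom>. norm (blinfun_apply K x) \<le> e * norm x))"

text \<open>Reduces compactness of the final operators to pointwise norm comparison with |T| -
  \<alpha> I.\<close>

lemma ess_zero_dominated:
  assumes "ess_zero K" "\<And>x. norm (blinfun_apply L x) \<le> c * norm (blinfun_apply K x)"
  shows "ess_zero L"
  unfolding ess_zero_def
proof (intro allI impI)
  fix e :: real assume "e > 0"
  define d where "d = \<bar>c\<bar> + 1"
  have d: "d > 0" "c \<le> d" by (auto simp: d_def)
  obtain F where F: "finite F" "\<And>x. x \<in> F\<^sup>\<bottom> \<Longrightarrow> norm (K x) \<le> (e / d) * norm x"
    using assms(1) \<open>e > 0\<close> d unfolding ess_zero_def by (meson divide_pos_pos)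
  have "norm (L x) \<le> e * norm x" if "x \<in> F\<^sup>\<bottom>" for x
  proof -
    have "norm (L x) \<le> d * norm (K x)"
      using assms(2)[of x] mult_right_mono[OF d(2), of "norm (K x)"] by simp
    also have "\<dots> \<le> d * ((e / d) * norm x)" using F(2)[OF that] d by (intro mult_left_mono) auto
    finally show ?thesis using d by simp
  qed
  with F(1) show "\<exists>F. finite F \<and> (\<forall>x\<in>F\<^sup>\<bottom>. norm (L x) \<le> e * norm x)" by blast
qed

text \<open>Gram-Schmidt, one vector at a time. The inclusion of orthogonal complements stands in
  for the statement that \<open>E\<close> spans \<open>F\<close>.\<close>

lemma finite_orthonormal_exists:
  assumes "finite F"
  shows "\<exists>E. finite E \<and> pairwise orthogonal E \<and> (\<forall>e\<in>E. norm e = 1) \<and> E\<^sup>\<bottom> \<subseteq> F\<^sup>\<bottom>"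
  using assms
proof induction
  case empty
  then show ?case by (intro exI[of _ "{}"]) (auto simp: pairwise_def)
next
  case (insert v F)
  then obtain E where E: "finite E" "pairwise orthogonal E" "\<forall>e\<in>E. norm e = 1" "E\<^sup>\<bottom> \<subseteq> F\<^sup>\<bottom>"
    by blast
  define p where "p = (\<Sum>e\<in>E. inner v e *\<^sub>R e)"
  define u where "u = v - p"
  have u: "inner u e = 0" if "e \<in> E" for e
  proof -
    have "inner p e = (\<Sum>d\<in>E. if d = e then inner v e else 0)"
      unfolding p_def inner_sum_left
    proof (rule sum.cong)
      fix d assume "d \<in> E"
      then show "inner (inner v d *\<^sub>R d) e = (if d = e then inner v e else 0)"
        using E(2,3) that by (auto simp: pairwise_def orthogonal_def norm_eq_1)
    qed simp
    then show ?thesis using E(1) that by (simp add: u_def inner_diff_left)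
  qed
  have v: "inner x v = 0" if "x \<in> E\<^sup>\<bottom>" "inner x u = 0" for x
  proof -
    have "inner x p = 0" using that(1) by (simp add: p_def inner_sum_right orthogonal_comp_inner)
    with that(2) show ?thesis by (simp add: u_def inner_diff_right)
  qed
  show ?case
  proof (cases "u = 0")
    case True
    then have "E\<^sup>\<bottom> \<subseteq> (insert v F)\<^sup>\<bottom>" using v E(4) by (auto simp: orthogonal_comp_inner)
    with E show ?thesis by blast
  next
    case False
    define w where "w = (1 / norm u) *\<^sub>R u"
    have "(insert w E)\<^sup>\<bottom> \<subseteq> (insert v F)\<^sup>\<bottom>"
    proof
      fix x assume x: "x \<in> (insert w E)\<^sup>\<bottom>"
      then have "x \<in> E\<^sup>\<bottom>" "inner x u = 0" using False by (auto simp: orthogonal_comp_inner w_def)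
      then show "x \<in> (insert v F)\<^sup>\<bottom>" using v E(4) by (auto simp: orthogonal_comp_inner)
    qed
    moreover have "pairwise orthogonal (insert w E)"
      using E(2) u by (auto simp: pairwise_insert w_def orthogonal_def inner_commute)
    moreover have "norm w = 1" using False by (simp add: w_def)
    ultimately show ?thesis using E by (intro exI[of _ "insert w E"]) auto
  qed
qed

lemma compact_bounded_combinations:
  fixes g :: "'i \<Rightarrow> 'a::real_normed_vector"
  assumes "finite E"
  shows "\<exists>C. compact C \<and> (\<forall>c. (\<forall>e\<in>E. \<bar>c e\<bar> \<le> R) \<longrightarrow> (\<Sum>e\<in>E. c e *\<^sub>R g e) \<in> C)"
  using assms
proof induction
  case empty
  show ?case by (intro exI[of _ "{0}"]) auto
next
  case (insert a E)
  then obtain C where C: "compact C" "\<And>c. (\<forall>e\<in>E. \<bar>c e\<bar> \<le> R) \<Longrightarrow> (\<Sum>e\<in>E. c e *\<^sub>R g e) \<in> C"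
    by blast
  have "compact ((\<lambda>t. t *\<^sub>R g a) ` {-R..R})"
    by (intro compact_continuous_image continuous_intros compact_Icc)
  from compact_sums[OF this C(1)] show ?case
  proof (intro exI conjI allI impI)
    fix c assume c: "\<forall>e\<in>insert a E. \<bar>c e\<bar> \<le> R"
    then have "c a \<in> {-R..R}" by auto
    moreover have "(\<Sum>e\<in>insert a E. c e *\<^sub>R g e) = c a *\<^sub>R g a + (\<Sum>e\<in>E. c e *\<^sub>R g e)"
      using insert by simp
    ultimately show "(\<Sum>e\<in>insert a E. c e *\<^sub>R g e) \<in>
        {x + y |x y. x \<in> (\<lambda>t. t *\<^sub>R g a) ` {-R..R} \<and> y \<in> C}"
      using C(2)[of c] c by blast
  qed
qed

text \<open>Split x into its projection p onto the span of a finite orthonormal set and the rest.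
  The images K p stay in one compact set and K (x - p) is uniformly small, so the image of
  \<open>S\<close> is totally bounded.\<close>

lemma ess_zero_compact:
  fixes K :: "'a::{real_inner,banach} \<Rightarrow>\<^sub>L 'a"
  assumes K: "ess_zero K" and "bounded S"
  shows "compact (closure (blinfun_apply K ` S))"
  unfolding compact_eq_totally_bounded
proof (intro conjI allI impI)
  show "complete (closure (K ` S))" by (simp add: complete_eq_closed)
  fix e :: real assume "e > 0"
  obtain R where R: "R > 0" "\<And>x. x \<in> S \<Longrightarrow> norm x \<le> R"
    using \<open>bounded S\<close> by (auto simp: bounded_pos)
  have "e / (4 * R) > 0" using \<open>e > 0\<close> R by simp
  then obtain F where F: "finite F" "\<And>x. x \<in> F\<^sup>\<bottom> \<Longrightarrow> norm (K x) \<le> e / (4 * R) * norm x"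
    using K unfolding ess_zero_def by meson
  obtain E where E: "finite E" "pairwise orthogonal E" "\<forall>e\<in>E. norm e = 1" "E\<^sup>\<bottom> \<subseteq> F\<^sup>\<bottom>"
    using finite_orthonormal_exists[OF F(1)] by blast
  obtain C where C: "compact C" "\<And>c. (\<forall>e\<in>E. \<bar>c e\<bar> \<le> R) \<Longrightarrow> (\<Sum>e\<in>E. c e *\<^sub>R K e) \<in> C"
    using compact_bounded_combinations[OF E(1), of R K] by blast
  obtain k where k: "finite k" "C \<subseteq> (\<Union>x\<in>k. ball x (e / 4))"
    using C(1) \<open>e > 0\<close> unfolding compact_eq_totally_bounded by (meson zero_less_divide_iff zero_less_numeral)
  \<comment> \<open>An \<open>e / 4\<close> net of the compact set plus an \<open>e / 4\<close>
    remainder gives radius \<open>e / 2\<close>. The balls are closed so that their finite union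
    also contains the closure; open balls of radius \<open>e\<close> absorb them.\<close>
  have "K ` S \<subseteq> (\<Union>x\<in>k. cball x (e / 2))"
  proof
    fix z assume "z \<in> K ` S"
    then obtain x where x: "x \<in> S" "z = K x" by blast
    define p where "p = (\<Sum>e\<in>E. inner x e *\<^sub>R e)"
    have orth: "inner (x - p) d = 0" if "d \<in> E" for d
    proof -
      have "inner p d = (\<Sum>e\<in>E. if e = d then inner x d else 0)"
        unfolding p_def inner_sum_left
      proof (rule sum.cong)
        fix e assume "e \<in> E"
        then show "inner (inner x e *\<^sub>R e) d = (if e = d then inner x d else 0)"
          using E(2,3) that by (auto simp: pairwise_def orthogonal_def norm_eq_1)
      qed simp
      then show ?thesis using E(1) that by (simp add: inner_diff_left)
    qed
    then have "x - p \<in> F\<^sup>\<bottom>" using E(4) by (auto simp: orthogonal_comp_inner)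
    have "norm (x - p) \<le> norm x"
    proof -
      have "inner (x - p) p = 0" unfolding p_def inner_sum_right
        using orth by (intro sum.neutral) (simp add: p_def)
      then have "(norm x)\<^sup>2 = (norm (x - p))\<^sup>2 + (norm p)\<^sup>2"
        by (simp add: power2_norm_eq_inner inner_diff inner_commute)
      then have "(norm (x - p))\<^sup>2 \<le> (norm x)\<^sup>2" by simp
      then show ?thesis by (rule power2_le_imp_le) simp
    qed
    then have "norm (x - p) \<le> R" using R(2)[OF x(1)] by linarith
    then have "norm (K (x - p)) \<le> e / (4 * R) * R"
      using F(2)[OF \<open>x - p \<in> F\<^sup>\<bottom>\<close>] mult_left_mono[of "norm (x - p)" R "e / (4 * R)"]
        \<open>e / (4 * R) > 0\<close> by linarith
    then have 1: "norm (K (x - p)) \<le> e / 4" using R by simp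
    have "\<bar>inner x d\<bar> \<le> R" if "d \<in> E" for d
      using Cauchy_Schwarz_ineq2[of x d] E(3) that R(2)[OF x(1)] by auto
    then have "(\<Sum>e\<in>E. inner x e *\<^sub>R K e) \<in> C" by (intro C) blast
    moreover have "(\<Sum>e\<in>E. inner x e *\<^sub>R K e) = K p"
      by (simp add: p_def blinfun.sum_right blinfun.scaleR_right)
    ultimately obtain c where c: "c \<in> k" "dist c (K p) < e / 4" using k by auto
    have "K x - c = K (x - p) + (K p - c)" by (simp add: blinfun.diff_right)
    then have "norm (K x - c) \<le> norm (K (x - p)) + norm (K p - c)" by (metis norm_triangle_ineq)
    also have "\<dots> \<le> e / 2" using 1 c(2) by (simp add: dist_norm norm_minus_commute)
    finally have "z \<in> cball c (e / 2)" by (simp add: x dist_norm norm_minus_commute)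
    with c(1) show "z \<in> (\<Union>x\<in>k. cball x (e / 2))" by blast
  qed
  moreover have "closed (\<Union>x\<in>k. cball x (e / 2))" using k(1) by (intro closed_UN) auto
  ultimately have "closure (K ` S) \<subseteq> (\<Union>x\<in>k. cball x (e / 2))" by (rule closure_minimal)
  also have "\<dots> \<subseteq> (\<Union>x\<in>k. ball x e)" using \<open>e > 0\<close> by fastforce
  finally show "\<exists>k. finite k \<and> closure (K ` S) \<subseteq> (\<Union>x\<in>k. ball x e)" using k(1) by blast
qed

text \<open>Polarization: with y = S x, the form at x + t y minus the form at x - t y equals 4 t
  ||y||^2, while the hypothesis and the parallelogram law bound it from above. The estimate concerns
  single vectors because V need not be invariant under S.\<close>

lemma symmetric_norm_le:
  assumes S: "adjoint_of S S" and V: "subspace V"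
    and num: "\<And>z. z \<in> V \<Longrightarrow> \<bar>inner (blinfun_apply S z) z\<bar> \<le> e * (norm z)\<^sup>2"
    and x: "x \<in> V" "blinfun_apply S x \<in> V"
  shows "norm (blinfun_apply S x) \<le> e * norm x"
proof (cases "S x = 0")
  case True
  show ?thesis
  proof (cases "x = 0")
    case False
    then have "0 \<le> e * (norm x)\<^sup>2" using num[OF x(1)] by linarith
    with False have "0 \<le> e" by (simp add: zero_le_mult_iff)
    with True show ?thesis by simp
  qed simp
next
  case False
  then have x0: "x \<noteq> 0" by auto
  define y where "y = S x"
  \<comment> \<open>Balances the two terms: \<open>t *\<^sub>R y\<close> has the norm of
    \<open>x\<close>.\<close>
  define t where "t = norm x / norm y"
  have t: "t * norm y = norm x" using False by (simp add: t_def y_def)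
  have mem: "x + t *\<^sub>R y \<in> V" "x - t *\<^sub>R y \<in> V"
    using V x by (auto simp: y_def intro: subspace_add subspace_diff subspace_scale)
  have "inner (S (x + t *\<^sub>R y)) (x + t *\<^sub>R y) - inner (S (x - t *\<^sub>R y)) (x - t *\<^sub>R y)
      = 2 * t * (inner (S x) y + inner (S y) x)"
    by (simp add: blinfun.bilinear_simps inner_add inner_diff algebra_simps)
  also have "\<dots> = 4 * t * (norm y)\<^sup>2"
    using adjoint_ofD[OF S, of y x] by (simp add: y_def power2_norm_eq_inner inner_commute)
  finally have "4 * t * (norm y)\<^sup>2 \<le> e * (norm (x + t *\<^sub>R y))\<^sup>2 + e * (norm (x - t *\<^sub>R y))\<^sup>2"
    using num[OF mem(1)] num[OF mem(2)] by linarith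
  also have "\<dots> = e * (2 * (norm x)\<^sup>2 + 2 * (t * norm y)\<^sup>2)"
    by (simp add: power2_norm_eq_inner power_mult_distrib inner_add inner_diff algebra_simps
        power2_eq_square[of t])
  also have "4 * t * (norm y)\<^sup>2 = 4 * (norm x * norm y)"
    by (simp add: power2_eq_square flip: t)
  finally have "norm x * norm y \<le> norm x * (e * norm x)"
    unfolding t by (simp add: power2_eq_square algebra_simps)
  then show ?thesis using x0 by (simp add: y_def)
qed

lemma symmetric_ess_zero:
  assumes S: "adjoint_of S S"
    and "\<And>e. e > 0 \<Longrightarrow> \<exists>F. finite F \<and> (\<forall>x\<in>F\<^sup>\<bottom>. \<bar>inner (blinfun_apply S x) x\<bar> \<le> e * (norm x)\<^sup>2)"
  shows "ess_zero S"
  unfolding ess_zero_def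
proof (intro allI impI)
  fix e :: real assume "e > 0"
  then obtain F where F: "finite F" "\<And>x. x \<in> F\<^sup>\<bottom> \<Longrightarrow> \<bar>inner (S x) x\<bar> \<le> e * (norm x)\<^sup>2"
    using assms(2) by metis
  have "norm (S x) \<le> e * norm x" if "x \<in> (F \<union> S ` F)\<^sup>\<bottom>" for x
  proof (rule symmetric_norm_le[OF S subspace_orthogonal_comp F(2)])
    show "x \<in> F\<^sup>\<bottom>" using that by (auto simp: orthogonal_comp_inner)
    show "S x \<in> F\<^sup>\<bottom>" using that adjoint_ofD[OF S] by (auto simp: orthogonal_comp_inner)
  qed
  with F(1) show "\<exists>F. finite F \<and> (\<forall>x\<in>F\<^sup>\<bottom>. norm (S x) \<le> e * norm x)"
    by (intro exI[of _ "F \<union> S ` F"]) auto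
qed

section \<open>Vanishing oscillation of ||T x||^2 on subspaces of finite codimension\<close>

definition ess_const :: "('a::real_inner \<Rightarrow>\<^sub>L 'a) \<Rightarrow> bool"
  where "ess_const T \<longleftrightarrow> (\<forall>e>0. \<exists>F. finite F \<and>
    (\<forall>x\<in>F\<^sup>\<bottom>. \<forall>y\<in>F\<^sup>\<bottom>. norm x = 1 \<longrightarrow> norm y = 1 \<longrightarrow>
      (norm (blinfun_apply T x))\<^sup>2 \<le> (norm (blinfun_apply T y))\<^sup>2 + e))"

text \<open>On unit vectors ||U x||^2 and ||T x||^2 are uniformly close when U is near T. The
  tolerance \<open>e\<close> is split into thirds: one for the oscillation of U and one for each of
  the two replacements.\<close>

lemma ess_const_closure:
  assumes T: "T \<in> closure A" and A: "\<And>U. U \<in> A \<Longrightarrow> ess_const U"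
  shows "ess_const T"
  unfolding ess_const_def
proof (intro allI impI)
  fix e :: real assume "e > 0"
  \<comment> \<open>Bounds ||U x|| + ||T x|| on unit vectors once U is within distance 1 of
    T.\<close>
  define c where "c = 2 * norm T + 1"
  have c: "c > 0" by (simp add: c_def add_nonneg_pos)
  define d where "d = min 1 (e / (3 * c))"
  have d: "d > 0" "d \<le> 1" "d * c \<le> e / 3"
  proof -
    show "d > 0" "d \<le> 1" using \<open>e > 0\<close> c by (auto simp: d_def)
    have "d * c \<le> e / (3 * c) * c" using c by (intro mult_right_mono) (auto simp: d_def)
    then show "d * c \<le> e / 3" using c by simp
  qed
  obtain U where U: "U \<in> A" "norm (U - T) < d"
    using T d(1) unfolding closure_approachable by (auto simp: dist_norm)
  have close: "\<bar>(norm (U x))\<^sup>2 - (norm (T x))\<^sup>2\<bar> \<le> e / 3" if "norm x = 1" for x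
  proof -
    have "norm (U x - T x) \<le> d"
      using norm_blinfun[of "U - T" x] U(2) that by (simp add: blinfun.diff_left)
    then have 1: "\<bar>norm (U x) - norm (T x)\<bar> \<le> d"
      using norm_triangle_ineq3[of "U x" "T x"] by linarith
    have "norm (T x) \<le> norm T" using norm_blinfun[of T x] that by simp
    then have 2: "\<bar>norm (U x) + norm (T x)\<bar> \<le> c" using 1 d(2) by (simp add: c_def)
    have "(norm (U x))\<^sup>2 - (norm (T x))\<^sup>2 = (norm (U x) - norm (T x)) * (norm (U x) + norm (T x))"
      by (simp add: power2_eq_square algebra_simps)
    then have "\<bar>(norm (U x))\<^sup>2 - (norm (T x))\<^sup>2\<bar> \<le> d * c"
      unfolding abs_mult using 1 2 d(1) by (simp only: abs_mult) (intro mult_mono, auto)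
    with d(3) show ?thesis by linarith
  qed
  have "e / 3 > 0" using \<open>e > 0\<close> by simp
  from A[OF U(1), unfolded ess_const_def, THEN spec, THEN mp, OF this]
  obtain F where F: "finite F"
    "\<forall>x\<in>F\<^sup>\<bottom>. \<forall>y\<in>F\<^sup>\<bottom>. norm x = 1 \<longrightarrow> norm y = 1 \<longrightarrow> (norm (U x))\<^sup>2 \<le> (norm (U y))\<^sup>2 + e / 3"
    by (elim exE conjE)
  have "(norm (T x))\<^sup>2 \<le> (norm (T y))\<^sup>2 + e"
    if "x \<in> F\<^sup>\<bottom>" "y \<in> F\<^sup>\<bottom>" "norm x = 1" "norm y = 1" for x y
    using F(2)[rule_format, OF that] close[OF that(3)] close[OF that(4)] by linarith
  with F(1) show "\<exists>F. finite F \<and> (\<forall>x\<in>F\<^sup>\<bottom>. \<forall>y\<in>F\<^sup>\<bottom>. norm x = 1 \<longrightarrow> norm y = 1 \<longrightarrow>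
      (norm (T x))\<^sup>2 \<le> (norm (T y))\<^sup>2 + e)" by blast
qed

text \<open>Each tolerance 1/(n + 1) yields an approximate value in a compact interval; the limit of
  a convergent subsequence serves all tolerances. Homogeneity then turns the estimate on unit
  vectors into one for the quadratic form of T'T - l I.\<close>

lemma ess_const_value:
  assumes "ess_const T"
  shows "\<exists>l\<ge>0. \<forall>e>0. \<exists>F. finite F \<and>
    (\<forall>x\<in>F\<^sup>\<bottom>. \<bar>(norm (blinfun_apply T x))\<^sup>2 - l * (norm x)\<^sup>2\<bar> \<le> e * (norm x)\<^sup>2)"
proof -
  let ?near = "\<lambda>F l e. \<forall>x\<in>F\<^sup>\<bottom>. norm x = 1 \<longrightarrow> \<bar>(norm (T x))\<^sup>2 - l\<bar> \<le> e"
  have "\<exists>F l. finite F \<and> l \<in> {0..(norm T)\<^sup>2} \<and> ?near F l e" if e: "e > 0" for e :: real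
  proof -
    obtain F where F: "finite F" "\<And>x y. x \<in> F\<^sup>\<bottom> \<Longrightarrow> y \<in> F\<^sup>\<bottom> \<Longrightarrow> norm x = 1 \<Longrightarrow> norm y = 1 \<Longrightarrow>
        (norm (T x))\<^sup>2 \<le> (norm (T y))\<^sup>2 + e"
      using assms e unfolding ess_const_def by meson
    show ?thesis
    proof (cases "\<exists>y\<in>F\<^sup>\<bottom>. norm y = 1")
      case True
      then obtain y where y: "y \<in> F\<^sup>\<bottom>" "norm y = 1" by blast
      have "norm (T y) \<le> norm T" using norm_blinfun[of T y] y by simp
      then have "(norm (T y))\<^sup>2 \<in> {0..(norm T)\<^sup>2}" by (simp add: power_mono)
      moreover have "?near F ((norm (T y))\<^sup>2) e"
      proof (intro ballI impI)
        fix x assume "x \<in> F\<^sup>\<bottom>" "norm x = 1"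
        then show "\<bar>(norm (T x))\<^sup>2 - (norm (T y))\<^sup>2\<bar> \<le> e"
          using F(2)[of x y] F(2)[of y x] y by linarith
      qed
      ultimately show ?thesis using F(1) by blast
    next
      case False
      \<comment> \<open>Without unit vectors in the complement every value is admissible; 0 is a
        placeholder in the interval.\<close>
      then show ?thesis using F(1) by (intro exI[of _ F] exI[of _ 0]) auto
    qed
  qed
  then have "\<forall>n. \<exists>F l. finite F \<and> l \<in> {0..(norm T)\<^sup>2} \<and> ?near F l (1 / real (Suc n))"
    by simp
  then obtain F l where Fl: "\<And>n. finite (F n)" "\<And>n. l n \<in> {0..(norm T)\<^sup>2}"
    "\<And>n. ?near (F n) (l n) (1 / real (Suc n))"
    by metis
  obtain r L where L: "L \<in> {0..(norm T)\<^sup>2}" "strict_mono r" "(l \<circ> r) \<longlonglongrightarrow> L"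
    using compact_Icc[of 0 "(norm T)\<^sup>2"] Fl(2) unfolding compact_def by metis
  have "\<exists>F. finite F \<and> (\<forall>x\<in>F\<^sup>\<bottom>. \<bar>(norm (T x))\<^sup>2 - L * (norm x)\<^sup>2\<bar> \<le> e * (norm x)\<^sup>2)"
    if e: "e > 0" for e
  proof -
    obtain n0 where n0: "\<And>n. n \<ge> n0 \<Longrightarrow> \<bar>l (r n) - L\<bar> < e / 2"
      using LIMSEQ_D[OF L(3), of "e / 2"] e by auto
    obtain n1 where n1: "1 / real (Suc n1) < e / 2" using nat_approx_posE[of "e / 2"] e by auto
    define n where "n = max n0 n1"
    have "n1 \<le> r n" using seq_suble[OF L(2), of n] by (simp add: n_def)
    then have "1 / real (Suc (r n)) \<le> 1 / real (Suc n1)" by (auto intro!: divide_left_mono)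
    then have unit: "\<bar>(norm (T x))\<^sup>2 - L\<bar> \<le> e" if "x \<in> (F (r n))\<^sup>\<bottom>" "norm x = 1" for x
    proof -
      have "\<bar>(norm (T x))\<^sup>2 - l (r n)\<bar> \<le> 1 / real (Suc (r n))"
        using Fl(3)[of "r n"] that by blast
      moreover have "\<bar>l (r n) - L\<bar> < e / 2" by (rule n0) (simp add: n_def)
      ultimately show ?thesis using \<open>1 / real (Suc (r n)) \<le> 1 / real (Suc n1)\<close> n1 by linarith
    qed
    have "\<bar>(norm (T x))\<^sup>2 - L * (norm x)\<^sup>2\<bar> \<le> e * (norm x)\<^sup>2" if x: "x \<in> (F (r n))\<^sup>\<bottom>" for x
    proof (cases "x = 0")
      case False
      have "\<bar>(norm (T ((1 / norm x) *\<^sub>R x)))\<^sup>2 - L\<bar> \<le> e"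
        using orthogonal_comp_normalize[OF x False] unit by blast
      then have "\<bar>(norm (T x))\<^sup>2 / (norm x)\<^sup>2 - L\<bar> * (norm x)\<^sup>2 \<le> e * (norm x)\<^sup>2"
        by (intro mult_right_mono) (auto simp: blinfun.scaleR_right power_divide)
      also have "\<bar>(norm (T x))\<^sup>2 / (norm x)\<^sup>2 - L\<bar> * (norm x)\<^sup>2 = \<bar>((norm (T x))\<^sup>2 / (norm x)\<^sup>2 - L) * (norm x)\<^sup>2\<bar>"
        by (simp add: abs_mult)
      finally show ?thesis using False by (simp add: left_diff_distrib)
    qed (simp add: blinfun.zero_right)
    with Fl(1) show ?thesis by blast
  qed
  with L(1) show ?thesis by auto
qed


section \<open>Absolutely norm attaining operators\<close>

lemma cinner_scaleC_right: "cinner x (a *\<^sub>C y) = cnj a * cinner x y"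
proof -
  have "cinner x (a *\<^sub>C y) = cnj (cinner (a *\<^sub>C y) x)" by (rule cinner_commute)
  also have "\<dots> = cnj a * cinner x y" by (simp add: cinner_scaleC_left cinner_commute[of x y])
  finally show ?thesis .
qed

lemma Im_cinner: "Im (cinner x y) = inner x (\<i> *\<^sub>C y)"
  by (simp add: cinner_scaleC_right flip: Re_cinner)

text \<open>Lets complements of finite sets for the real inner product express complex
  orthogonality: include i y along with y.\<close>

lemma cinner_eq_0_iff: "cinner x y = 0 \<longleftrightarrow> inner x y = 0 \<and> inner x (\<i> *\<^sub>C y) = 0"
  by (simp add: complex_eq_iff Re_cinner Im_cinner)

lemma cinner_diff_left: "cinner (x - y) z = cinner x z - cinner y z"
  using cinner_add_left[of "x - y" y z] by simp

lemma cinner_diff_right: "cinner z (x - y) = cinner z x - cinner z y"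
  by (simp add: complex_eq_iff Re_cinner Im_cinner inner_diff_right complex_vector.scale_right_diff_distrib)

lemma cinner_scaleR_right: "cinner x (r *\<^sub>R y) = of_real r * cinner x y"
  by (simp flip: scaleC_of_real add: cinner_scaleC_right)

lemma cinner_scaleR_left: "cinner (r *\<^sub>R x) y = of_real r * cinner x y"
  by (simp flip: scaleC_of_real add: cinner_scaleC_left)

lemma cinner_zero_left [simp]: "cinner 0 x = 0"
  using cinner_diff_left[of 0 0 x] by simp

lemma cinner_self: "cinner x x = of_real ((norm x)\<^sup>2)"
proof -
  have "cinner x x = cnj (cinner x x)" by (rule cinner_commute)
  then have "Im (cinner x x) = - Im (cinner x x)" by (metis cnj.simps(2))
  then show ?thesis by (simp add: complex_eq_iff Re_cinner power2_norm_eq_inner)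
qed

lemma BHD: "T \<in> BH \<Longrightarrow> blinfun_apply T (a *\<^sub>C x) = a *\<^sub>C T x"
  by (simp add: BH_def)

text \<open>The imaginary part of <u, v> is the real part of <-i u, v>, so complex linearity of
  \<open>T\<close> upgrades the real adjoint relation to the complex one.\<close>

lemma cinner_adjoint_of:
  assumes "T \<in> BH" "adjoint_of T T'"
  shows "cinner (blinfun_apply T x) y = cinner x (T' y)"
proof (rule complex_eqI)
  show "Re (cinner (T x) y) = Re (cinner x (T' y))"
    by (simp add: Re_cinner adjoint_ofD[OF assms(2)])
  have Im: "Im (cinner u v) = inner (- \<i> *\<^sub>C u) v" for u v :: 'a
    by (simp only: cinner_scaleC_left Re_cinner[symmetric]) simp
  show "Im (cinner (T x) y) = Im (cinner x (T' y))"
    unfolding Im BHD[OF assms(1), symmetric] by (rule adjoint_ofD[OF assms(2)])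
qed

lemma closed_cinner_zero: "closed {x. cinner x y = 0}"
  unfolding cinner_eq_0_iff by (intro closed_Collect_conj closed_Collect_eq continuous_intros)

text \<open>The form \<open>s\<^sup>2 \<parallel>x\<parallel>\<^sup>2 - \<parallel>T x\<parallel>\<^sup>2\<close>, with \<open>s\<close> the norm of \<open>T\<close> on \<open>M\<close>, is nonnegative on \<open>M\<close>
  and vanishes at a maximizer \<open>x\<close>; its polarization therefore vanishes at \<open>(x, y)\<close> for all
  \<open>y\<close> in \<open>M\<close>.\<close>

lemma norm_attaining_maximizer:
  assumes "csubspace M" "norm_attaining_on T M"
  obtains x where "x \<in> M" "norm x = 1" "norm (blinfun_apply T x) = restr_norm T M"
    "\<And>y. y \<in> M \<Longrightarrow> norm (T y) \<le> restr_norm T M * norm y"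
    "\<And>y. y \<in> M \<Longrightarrow> inner (T x) (T y) = (restr_norm T M)\<^sup>2 * inner x y"
proof -
  define s where "s = restr_norm T M"
  obtain x where x: "x \<in> M" "norm x = 1" "norm (T x) = s"
    using assms(2) unfolding norm_attaining_on_def s_def by blast
  have bdd: "bdd_above ((\<lambda>y. norm (T y) / norm y) ` M)"
    using norm_blinfun[of T] by (intro bdd_aboveI[of _ "norm T"]) (auto simp: divide_le_eq)
  have le: "norm (T y) \<le> s * norm y" if "y \<in> M" for y
  proof (cases "y = 0")
    case False
    have "norm (T y) / norm y \<le> s"
      unfolding s_def restr_norm_def by (intro cSUP_upper that bdd)
    then show ?thesis using False by (simp add: divide_le_eq)
  qed (simp add: blinfun.zero_right)
  have "inner (T x) (T y) = s\<^sup>2 * inner x y" if y: "y \<in> M" for y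
  proof -
    have "0 \<le> (2 * (s\<^sup>2 * inner x y - inner (T x) (T y))) * t
        + (s\<^sup>2 * (norm y)\<^sup>2 - (norm (T y))\<^sup>2) * t\<^sup>2" for t
    proof -
      have "complex_of_real t *\<^sub>C y \<in> M" using assms(1) y by (rule complex_vector.subspace_scale)
      then have "x + t *\<^sub>R y \<in> M"
        using assms(1) x(1) unfolding scaleC_of_real by (intro complex_vector.subspace_add)
      then have "(norm (T (x + t *\<^sub>R y)))\<^sup>2 \<le> (s * norm (x + t *\<^sub>R y))\<^sup>2"
        by (intro power_mono le) auto
      moreover have "(norm (x + t *\<^sub>R y))\<^sup>2 = 1 + 2 * t * inner x y + t\<^sup>2 * (norm y)\<^sup>2"
        using x(2) by (simp add: power2_norm_eq_inner norm_eq_1 inner_add inner_commute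
            power2_eq_square[of t] algebra_simps)
      moreover have "(norm (T (x + t *\<^sub>R y)))\<^sup>2 = s\<^sup>2 + 2 * t * inner (T x) (T y) + t\<^sup>2 * (norm (T y))\<^sup>2"
        by (simp add: power2_norm_eq_inner blinfun.bilinear_simps inner_add inner_commute
            power2_eq_square[of t] algebra_simps flip: x(3))
      ultimately show ?thesis by (simp add: power_mult_distrib algebra_simps)
    qed
    from quadratic_nonneg_imp_linear_coeff_0[OF this] show ?thesis by simp
  qed
  with x le that show ?thesis unfolding s_def by blast
qed

text \<open>On the closed span of the \<open>g n\<close> the compression of T'T is diagonal with
  entries \<open>c n\<close>. A maximizer x with value s satisfies c_k <x, g_k> = s^2 <x, g_k>, yet
  every c_k lies strictly below s^2, so x is orthogonal to all \<open>g k\<close> and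
  vanishes.\<close>

lemma not_AN_of_increasing_sequence:
  fixes T :: "'a::chilbert_space \<Rightarrow>\<^sub>L 'a" and g :: "nat \<Rightarrow> 'a"
  assumes T: "T \<in> AN" "adjoint_of T T'"
    and g: "\<And>n. norm (g n) = 1"
    and c: "\<And>n. (norm (blinfun_apply T (g n)))\<^sup>2 = c n" "strict_mono c"
    and orth: "\<And>k n. k < n \<Longrightarrow> cinner (g n) (g k) = 0"
      "\<And>k n. k < n \<Longrightarrow> cinner (g n) (blinfun_apply T' (T (g k))) = 0"
  shows False
proof -
  have BH: "T \<in> BH" using T(1) by (simp add: AN_def)
  note adj = cinner_adjoint_of[OF BH T(2)]
  \<comment> \<open>\<open>M\<close> is the closed complex span of the sequence, obtained as a
    double orthogonal complement; closedness and the subspace laws are then immediate.\<close>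
  define Z where "Z = {y. \<forall>k. cinner y (g k) = 0}"
  define M where "M = {x. \<forall>y\<in>Z. cinner x y = 0}"
  have sub: "csubspace M"
    by (rule complex_vector.subspaceI) (auto simp: M_def cinner_add_left cinner_scaleC_left)
  have gM: "g k \<in> M" for k
    unfolding M_def Z_def using cinner_commute[of "g k"] by simp
  have "M = (\<Inter>y\<in>Z. {x. cinner x y = 0})" by (auto simp: M_def)
  then have "closed M" using closed_cinner_zero by auto
  moreover have "M \<noteq> {0}" using gM[of 0] g[of 0] by auto
  ultimately have "norm_attaining_on T M" using T(1) sub by (auto simp: AN_def)
  from norm_attaining_maximizer[OF sub this] obtain x s where x: "x \<in> M" "norm x = 1"
    "\<And>y. y \<in> M \<Longrightarrow> norm (T y) \<le> s * norm y" "\<And>y. y \<in> M \<Longrightarrow> inner (T x) (T y) = s\<^sup>2 * inner x y"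
    by metis
  have c_less: "c k < s\<^sup>2" for k
  proof -
    have "c k < c (Suc k)" using c(2) by (simp add: strict_mono_def)
    also have "\<dots> \<le> s\<^sup>2"
      using x(3)[OF gM[of "Suc k"]] g[of "Suc k"] by (simp flip: c(1) add: power_mono)
    finally show ?thesis .
  qed
  have "cinner x (g k) = 0" for k
  proof -
    let ?A = "T' (T (g k))"
    have "?A - c k *\<^sub>R g k \<in> Z"
      unfolding Z_def mem_Collect_eq cinner_diff_left cinner_scaleR_left
    proof (intro allI)
      fix j
      have "cinner ?A (g j) = cnj (cinner (g j) ?A)" by (rule cinner_commute)
      also have "\<dots> = cnj (cinner (T (g j)) (T (g k)))" by (simp add: adj)
      also have "\<dots> = cinner (T (g k)) (T (g j))" by (rule cinner_commute[symmetric])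
      finally have A: "cinner ?A (g j) = cinner (g k) (T' (T (g j)))" by (simp add: adj)
      consider "j < k" | "j = k" | "k < j" by linarith
      then show "cinner ?A (g j) - complex_of_real (c k) * cinner (g k) (g j) = 0"
      proof cases
        case 1
        then show ?thesis using orth A by simp
      next
        case 2
        have "cinner ?A (g k) = cinner (T (g k)) (T (g k))" using A adj 2 by simp
        then show ?thesis using 2 by (simp add: cinner_self c g)
      next
        case 3
        then have "cinner (g k) (g j) = 0" "cinner ?A (g j) = 0"
          using orth cinner_commute[of "g k"] cinner_commute[of ?A] by simp_all
        then show ?thesis by simp
      qed
    qed
    then have "cinner x (?A - c k *\<^sub>R g k) = 0" using x(1) by (simp add: M_def)
    then have xA: "cinner x ?A = c k * cinner x (g k)"
      by (simp add: cinner_diff_right cinner_scaleR_right)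
    \<comment> \<open>Testing the real maximizer equation against \<open>w *\<^sub>C g k\<close>
      makes both complex inner products real multiples of |w|^2.\<close>
    define w where "w = cinner x (g k)"
    have "w *\<^sub>C g k \<in> M" using sub gM by (rule complex_vector.subspace_scale)
    then have max: "inner (T x) (T (w *\<^sub>C g k)) = s\<^sup>2 * inner x (w *\<^sub>C g k)" by (rule x(4))
    have w: "cnj w * w = complex_of_real ((cmod w)\<^sup>2)"
      by (simp add: mult.commute flip: complex_norm_square)
    have "cinner (T x) (T (w *\<^sub>C g k)) = complex_of_real (c k * (cmod w)\<^sup>2)"
      by (simp add: BHD[OF BH] cinner_scaleC_right adj xA w mult.left_commute flip: w_def)
    then have "inner (T x) (T (w *\<^sub>C g k)) = c k * (cmod w)\<^sup>2"
      by (metis Re_cinner Re_complex_of_real)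
    moreover have "cinner x (w *\<^sub>C g k) = complex_of_real ((cmod w)\<^sup>2)"
      by (simp add: cinner_scaleC_right w flip: w_def)
    then have "inner x (w *\<^sub>C g k) = (cmod w)\<^sup>2"
      by (metis Re_cinner Re_complex_of_real)
    ultimately have "c k * (cmod w)\<^sup>2 = s\<^sup>2 * (cmod w)\<^sup>2" using max by auto
    with c_less[of k] show ?thesis by (simp add: w_def)
  qed
  then have "x \<in> Z" by (simp add: Z_def)
  with x(1) have "cinner x x = 0" by (simp add: M_def)
  with x(2) show False by (simp add: cinner_self)
qed

text \<open>The intermediate value theorem is applied on the segment from \<open>y\<close> to
  \<open>x\<close> to the homogeneous function ||T z||^2 - c ||z||^2, whose zero can be normalized
  afterwards.\<close>

lemma unit_vector_intermediate_value:
  fixes T :: "'a::real_inner \<Rightarrow>\<^sub>L 'a"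
  assumes V: "subspace V" and x: "x \<in> V" "norm x = 1" "c < (norm (blinfun_apply T x))\<^sup>2"
    and y: "y \<in> V" "norm y = 1" "(norm (blinfun_apply T y))\<^sup>2 < c"
  shows "\<exists>g\<in>V. norm g = 1 \<and> (norm (blinfun_apply T g))\<^sup>2 = c"
proof -
  define z where "z t = (1 - t) *\<^sub>R y + t *\<^sub>R x" for t :: real
  define f where "f t = (norm (T (z t)))\<^sup>2 - c * (norm (z t))\<^sup>2" for t
  have "\<exists>t\<ge>0. t \<le> 1 \<and> f t = 0"
  proof (rule IVT')
    show "f 0 \<le> 0" "0 \<le> f 1" using x y by (auto simp: f_def z_def)
    show "continuous_on {0..1} f"
      unfolding f_def z_def by (intro continuous_intros)
  qed simp
  then obtain t where t: "0 \<le> t" "t \<le> 1" "f t = 0" by blast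
  have zV: "z t \<in> V" unfolding z_def using V x y by (intro subspace_add subspace_scale)
  \<comment> \<open>The segment between unit vectors meets 0 only if y = -x, and then ||T x|| = ||T
    y||.\<close>
  have "z t \<noteq> 0"
  proof
    assume "z t = 0"
    then have eq: "(1 - t) *\<^sub>R y = - (t *\<^sub>R x)" by (simp add: z_def add_eq_0_iff)
    then have "norm ((1 - t) *\<^sub>R y) = norm (t *\<^sub>R x)" by simp
    then have "t = 1 / 2" using t x y by simp
    with eq have "(1 / 2) *\<^sub>R y = (1 / 2) *\<^sub>R (- x)" by simp
    then have "y = - x" by (rule scaleR_left_imp_eq[rotated]) simp
    with x y show False by (simp add: blinfun.minus_right)
  qed
  define g where "g = (1 / norm (z t)) *\<^sub>R z t"
  have "(norm (T g))\<^sup>2 = c"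
    using t(3) \<open>z t \<noteq> 0\<close> by (simp add: g_def f_def blinfun.scaleR_right power_divide)
  moreover have "g \<in> V" "norm g = 1"
    using V zV \<open>z t \<noteq> 0\<close> by (auto simp: g_def intro: subspace_scale)
  ultimately show ?thesis by blast
qed

text \<open>Each new vector is taken orthogonal to finitely many earlier vectors, to their images
  under T'T, and to i times all of these. Orthogonality to T'T g_k means that the images under
  \<open>T\<close> are orthogonal.\<close>

lemma orthogonal_sequence_exists:
  fixes T T' :: "'a::complex_inner \<Rightarrow>\<^sub>L 'a"
  assumes val: "\<And>F n. finite F \<Longrightarrow> \<exists>g\<in>F\<^sup>\<bottom>. norm g = 1 \<and> (norm (blinfun_apply T g))\<^sup>2 = c n"
  shows "\<exists>g. \<forall>n::nat. norm (g n) = 1 \<and> (norm (blinfun_apply T (g n)))\<^sup>2 = c n \<and>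
    (\<forall>k<n. cinner (g n) (g k) = 0 \<and> cinner (g n) (blinfun_apply T' (T (g k))) = 0)"
proof (rule dependent_wellorder_choice)
  fix n and g :: "nat \<Rightarrow> 'a"
  define F where "F = (\<Union>k<n. {g k, \<i> *\<^sub>C g k, T' (T (g k)), \<i> *\<^sub>C T' (T (g k))})"
  have "finite F" by (simp add: F_def)
  from val[OF this] obtain r where r: "r \<in> F\<^sup>\<bottom>" "norm r = 1" "(norm (T r))\<^sup>2 = c n" by blast
  have "cinner r (g k) = 0 \<and> cinner r (T' (T (g k))) = 0" if "k < n" for k
    using r(1) that by (auto simp: F_def orthogonal_comp_inner cinner_eq_0_iff)
  with r show "\<exists>r. norm r = 1 \<and> (norm (T r))\<^sup>2 = c n \<and>
    (\<forall>k<n. cinner r (g k) = 0 \<and> cinner r (T' (T (g k))) = 0)" by blast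
qed simp

theorem AN_ess_const:
  assumes T: "T \<in> AN"
  shows "ess_const T"
proof (rule ccontr)
  assume "\<not> ess_const T"
  then obtain e where e: "e > 0" and osc: "\<And>F. finite F \<Longrightarrow> \<exists>x\<in>F\<^sup>\<bottom>. \<exists>y\<in>F\<^sup>\<bottom>.
      norm x = 1 \<and> norm y = 1 \<and> (norm (T y))\<^sup>2 + e < (norm (T x))\<^sup>2"
    unfolding ess_const_def not_all not_imp by (metis not_le_imp_less)
  \<comment> \<open>The lower bounds of ||T y||^2 that hold on some subspace of finite codimension;
    their supremum \<open>m\<close> is the lower limit of the values of the form.\<close>
  define L where "L = {l. \<exists>F. finite F \<and> (\<forall>y\<in>F\<^sup>\<bottom>. norm y = 1 \<longrightarrow> l \<le> (norm (T y))\<^sup>2)}"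
  have L0: "0 \<in> L" by (auto simp: L_def intro: exI[of _ "{}"])
  have bdd: "bdd_above L"
  proof (rule bdd_aboveI)
    fix l assume "l \<in> L"
    then obtain F where F: "finite F" "\<And>y. y \<in> F\<^sup>\<bottom> \<Longrightarrow> norm y = 1 \<Longrightarrow> l \<le> (norm (T y))\<^sup>2"
      by (auto simp: L_def)
    obtain y where y: "y \<in> F\<^sup>\<bottom>" "norm y = 1" using osc[OF F(1)] by blast
    have "norm (T y) \<le> norm T" using norm_blinfun[of T y] y by simp
    then have "(norm (T y))\<^sup>2 \<le> (norm T)\<^sup>2" by (simp add: power_mono)
    with F(2)[OF y] show "l \<le> (norm T)\<^sup>2" by linarith
  qed
  define m where "m = Sup L"
  obtain l0 where l0: "l0 \<in> L" "m - e / 4 < l0"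
    using less_cSup_iff[OF _ bdd, of "m - e / 4"] L0 e by (auto simp: m_def)
  then obtain F0 where F0: "finite F0" "\<And>y. y \<in> F0\<^sup>\<bottom> \<Longrightarrow> norm y = 1 \<Longrightarrow> l0 \<le> (norm (T y))\<^sup>2"
    by (auto simp: L_def)
  have low: "\<exists>y\<in>F\<^sup>\<bottom>. norm y = 1 \<and> (norm (T y))\<^sup>2 < m + e / 4" if "finite F" for F
  proof (rule ccontr)
    assume "\<not> ?thesis"
    then have "m + e / 4 \<in> L" using that by (auto simp: L_def not_less)
    then have "m + e / 4 \<le> m" unfolding m_def by (rule cSup_upper) (rule bdd)
    with e show False by simp
  qed
  \<comment> \<open>Intersecting with the complement of \<open>F0\<close> keeps the smaller value
    above m - e/4, so an oscillation of more than e pushes the larger one above m + 3e/4.\<close>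
  have high: "\<exists>x\<in>F\<^sup>\<bottom>. norm x = 1 \<and> m + 3 * e / 4 < (norm (T x))\<^sup>2" if F: "finite F" for F
  proof -
    obtain x y where xy: "x \<in> (F \<union> F0)\<^sup>\<bottom>" "y \<in> (F \<union> F0)\<^sup>\<bottom>" "norm x = 1" "norm y = 1"
      "(norm (T y))\<^sup>2 + e < (norm (T x))\<^sup>2"
      using osc[OF finite_UnI[OF F F0(1)]] by blast
    have "x \<in> F\<^sup>\<bottom>" "y \<in> F0\<^sup>\<bottom>" using xy(1,2) by (auto simp: orthogonal_comp_inner)
    then show ?thesis using F0(2)[of y] xy l0(2) by (intro bexI[of _ x]) auto
  qed
  \<comment> \<open>Increases from m + e/2 towards m + 3e/4, hence stays between the values supplied
    by \<open>low\<close> and \<open>high\<close> on every subspace of finite codimension.\<close>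
  define c where "c n = m + 3 * e / 4 - (e / 2) / real (n + 2)" for n
  have c_mono: "strict_mono c"
    unfolding strict_mono_Suc_iff c_def using e by (auto intro!: divide_strict_left_mono)
  have "\<exists>g\<in>F\<^sup>\<bottom>. norm g = 1 \<and> (norm (T g))\<^sup>2 = c n" if F: "finite F" for F n
  proof -
    obtain x y where "x \<in> F\<^sup>\<bottom>" "norm x = 1" "m + 3 * e / 4 < (norm (T x))\<^sup>2"
      "y \<in> F\<^sup>\<bottom>" "norm y = 1" "(norm (T y))\<^sup>2 < m + e / 4"
      using low[OF F] high[OF F] by blast
    moreover have "0 \<le> (e / 2) / real (n + 2)" "(e / 2) / real (n + 2) \<le> e / 2"
      using e by (auto simp: divide_le_eq)
    then have "c n \<le> m + 3 * e / 4" "m + e / 4 \<le> c n" unfolding c_def by linarith+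
    ultimately show ?thesis
      by (intro unit_vector_intermediate_value[OF subspace_orthogonal_comp, where x = x and y = y]) auto
  qed
  note val = this
  obtain T' where "adjoint_of T T'" using adjoint_of_exists by blast
  moreover obtain g where "\<forall>n. norm (g n) = 1 \<and> (norm (T (g n)))\<^sup>2 = c n \<and>
      (\<forall>k<n. cinner (g n) (g k) = 0 \<and> cinner (g n) (T' (T (g k))) = 0)"
    using orthogonal_sequence_exists[of T c T', OF val] by blast
  ultimately show False
    by (intro not_AN_of_increasing_sequence[OF T, of T' g c]) (use c_mono in auto)
qed


section \<open>The polar decomposition of a normal operator\<close>

lemma scaleC_scaleR_commute: "a *\<^sub>C (r *\<^sub>R x) = r *\<^sub>R (a *\<^sub>C x)"
  by (simp add: scaleC_scaleC mult.commute flip: scaleC_of_real)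

lemma norm_scaleC: "norm (a *\<^sub>C x) = cmod a * norm x"
proof -
  have "complex_of_real ((norm (a *\<^sub>C x))\<^sup>2) = cinner (a *\<^sub>C x) (a *\<^sub>C x)" by (rule cinner_self[symmetric])
  also have "\<dots> = (a * cnj a) * cinner x x" by (simp add: cinner_scaleC_left cinner_scaleC_right)
  also have "\<dots> = complex_of_real ((cmod a * norm x)\<^sup>2)"
    by (simp add: cinner_self power_mult_distrib flip: complex_norm_square)
  finally have "(norm (a *\<^sub>C x))\<^sup>2 = (cmod a * norm x)\<^sup>2" by (simp only: of_real_eq_iff)
  then show ?thesis by (simp add: power2_eq_iff_nonneg)
qed

lemma bounded_linear_scaleC: "bounded_linear (\<lambda>x. a *\<^sub>C x)"
  by (rule bounded_linear_intro[of _ "cmod a"])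
     (simp_all add: scaleC_add_right scaleC_scaleR_commute norm_scaleC mult.commute)

text \<open>Complex linearity is read as commutation with real-linear operators, so the commutation
  clauses for square roots and for positive and negative parts deliver membership in
  \<open>BH\<close>.\<close>

lemma BH_iff_commute:
  "T \<in> BH \<longleftrightarrow> (\<forall>a. Blinfun (\<lambda>x. a *\<^sub>C x) o\<^sub>L T = T o\<^sub>L Blinfun (\<lambda>x. a *\<^sub>C x))"
proof -
  have "S = R \<longleftrightarrow> (\<forall>x. S x = R x)" for S R :: "'a \<Rightarrow>\<^sub>L 'a" by (auto intro: blinfun_eqI)
  then show ?thesis
    by (auto simp: BH_def bounded_linear_Blinfun_apply[OF bounded_linear_scaleC])
qed

lemma BH_compose: "T \<in> BH \<Longrightarrow> S \<in> BH \<Longrightarrow> T o\<^sub>L S \<in> BH"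
  by (simp add: BH_def)

lemma BH_diff: "T \<in> BH \<Longrightarrow> S \<in> BH \<Longrightarrow> T - S \<in> BH"
  by (simp add: BH_def blinfun.diff_left complex_vector.scale_right_diff_distrib)

lemma BH_scaleR: "T \<in> BH \<Longrightarrow> r *\<^sub>R T \<in> BH"
  by (simp add: BH_def blinfun.scaleR_left scaleC_scaleR_commute)

lemma BH_id: "id_blinfun \<in> BH"
  by (simp add: BH_def)

lemma BH_adjoint_of:
  assumes "T \<in> BH" "adjoint_of T T'"
  shows "T' \<in> BH"
  unfolding BH_def
proof (intro CollectI allI)
  fix a y
  have "cinner x (T' (a *\<^sub>C y)) = cinner x (a *\<^sub>C T' y)" for x
    by (simp add: cinner_scaleC_right flip: cinner_adjoint_of[OF assms])
  then have "inner x (T' (a *\<^sub>C y)) = inner x (a *\<^sub>C T' y)" for x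
    by (simp flip: Re_cinner)
  then show "T' (a *\<^sub>C y) = a *\<^sub>C T' y" using vector_eq_ldot by blast
qed

section \<open>Identification of \<open>adj\<close> and \<open>abs_op\<close>\<close>

lemma adj_eqI:
  assumes "T \<in> BH" "adjoint_of T S"
  shows "adj T = S"
  unfolding adj_def
proof (rule the_equality)
  show "\<forall>x y. cinner (T x) y = cinner x (S y)" using cinner_adjoint_of[OF assms] by blast
  fix R :: "'a \<Rightarrow>\<^sub>L 'a"
  assume "\<forall>x y. cinner (T x) y = cinner x (R y)"
  then have "adjoint_of T R" by (simp add: adjoint_of_def flip: Re_cinner)
  then show "R = S" using adjoint_of_unique assms(2) by blast
qed

lemma adjoint_of_adj: "T \<in> BH \<Longrightarrow> adjoint_of T (adj T)"
  using adjoint_of_exists[of T] adj_eqI by metis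

lemma selfadjoint_op_iff: "selfadjoint_op S \<longleftrightarrow> S \<in> BH \<and> adjoint_of S S"
  unfolding selfadjoint_op_def using adjoint_of_adj[of S] adj_eqI[of S S] by auto

lemma positive_op_iff:
  "positive_op P \<longleftrightarrow> P \<in> BH \<and> adjoint_of P P \<and> (\<forall>x. 0 \<le> inner (blinfun_apply P x) x)"
  by (simp add: positive_op_def selfadjoint_op_iff Re_cinner)

text \<open>A competing positive root P commutes with P^2 = T'T, hence with the constructed root,
  and \<open>sqrt_unique\<close> applies. This settles the definite description.\<close>

lemma abs_op_properties:
  assumes T: "T \<in> BH"
  shows "abs_op T \<in> BH" "is_sqrt (abs_op T) (adj T o\<^sub>L T)"
    "\<And>S. S o\<^sub>L (adj T o\<^sub>L T) = (adj T o\<^sub>L T) o\<^sub>L S \<Longrightarrow> S o\<^sub>L abs_op T = abs_op T o\<^sub>L S"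
proof -
  let ?A = "adj T o\<^sub>L T"
  obtain B where B: "is_sqrt B ?A" "\<And>S. S o\<^sub>L ?A = ?A o\<^sub>L S \<Longrightarrow> S o\<^sub>L B = B o\<^sub>L S"
    using sqrt_exists[OF adjoint_of_adj[OF T]] by blast
  have "?A \<in> BH" by (intro BH_compose T BH_adjoint_of[OF T adjoint_of_adj[OF T]])
  then have BH: "B \<in> BH" unfolding BH_iff_commute using B(2) by blast
  have "abs_op T = B"
    unfolding abs_op_def
  proof (rule the_equality)
    show "positive_op B \<and> B o\<^sub>L B = ?A" using B(1) BH by (simp add: is_sqrt_def positive_op_iff)
    fix P :: "'a \<Rightarrow>\<^sub>L 'a"
    assume "positive_op P \<and> P o\<^sub>L P = ?A"
    then have P: "is_sqrt P ?A" by (simp add: is_sqrt_def positive_op_iff)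
    then have "?A = P o\<^sub>L P" by (simp add: is_sqrt_def)
    then have "P o\<^sub>L ?A = ?A o\<^sub>L P" by (auto intro: blinfun_eqI)
    from sqrt_unique[OF P B(1) B(2)[OF this]] show "P = B" .
  qed
  with B BH show "abs_op T \<in> BH" "is_sqrt (abs_op T) ?A"
    "\<And>S. S o\<^sub>L ?A = ?A o\<^sub>L S \<Longrightarrow> S o\<^sub>L abs_op T = abs_op T o\<^sub>L S" by auto
qed

text \<open>For symmetric \<open>B\<close> the kernel and the closed range together span the space.
  In terms of adjoints: D B = 0 gives B D' = 0, so the range of D' lies in the kernel of B, where D
  vanishes; thus D D' = 0 and D' = 0.\<close>

lemma zero_on_range_and_kernel:
  fixes B D :: "'a::{real_inner,banach} \<Rightarrow>\<^sub>L 'a"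
  assumes B: "adjoint_of B B" and range: "\<And>x. blinfun_apply D (B x) = 0"
    and kernel: "\<And>x. blinfun_apply B x = 0 \<Longrightarrow> blinfun_apply D x = 0"
  shows "D = 0"
proof -
  obtain D' where D': "adjoint_of D D'" using adjoint_of_exists by blast
  have "inner x (B (D' y)) = 0" for x y
    using range[of x] adjoint_ofD[OF D', of "B x" y] adjoint_ofD[OF B, of x "D' y"] by simp
  then have "B (D' y) = 0" for y by (metis inner_eq_zero_iff)
  then have "D o\<^sub>L D' = 0" using kernel by (intro blinfun_eqI) simp
  then have "D' = 0" by (rule adjoint_comp_self_eq_0[OF adjoint_of_sym[OF D']])
  with D' have "inner (D x) y = 0" for x y by (simp add: adjoint_of_def)
  then show ?thesis by (metis blinfun_eqI blinfun.zero_left inner_eq_zero_iff)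
qed

text \<open>Operator identities are verified separately on the range and on the kernel of B = |T|.
  On the range, W B = T reduces them to facts about T; \<open>W\<close> and \<open>W'\<close> vanish
  on the kernel.\<close>

lemma polar_factor_normal:
  fixes T W B :: "'a::{real_inner,banach} \<Rightarrow>\<^sub>L 'a"
  assumes T': "adjoint_of T T'" and W': "adjoint_of W W'" and B: "is_sqrt B (T' o\<^sub>L T)"
    and normal: "T' o\<^sub>L T = T o\<^sub>L T'" and TB: "T o\<^sub>L B = B o\<^sub>L T"
    and T: "T = W o\<^sub>L B" and ker: "\<And>x. blinfun_apply W x = 0 \<longleftrightarrow> blinfun_apply T x = 0"
  shows "W o\<^sub>L B = B o\<^sub>L W" "W' o\<^sub>L B = B o\<^sub>L W'" "W' o\<^sub>L W = W o\<^sub>L W'"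
    "\<And>x. norm (blinfun_apply W x) \<le> norm x"
proof -
  have Bsym: "adjoint_of B B" and BB: "B (B x) = T' (T x)" for x
    using B blinfun_composeD[of B B T' T x] by (auto simp: is_sqrt_def)
  have Tx: "T x = W (B x)" for x unfolding T by simp
  have "adjoint_of T (B o\<^sub>L W')" unfolding T by (rule adjoint_of_compose[OF W' Bsym])
  with T' have "T' = B o\<^sub>L W'" by (rule adjoint_of_unique)
  then have T'x: "T' x = B (W' x)" for x by simp
  have kerB: "B x = 0 \<longleftrightarrow> W x = 0" for x
  proof -
    have "norm (B x) = norm (T x)"
      using norm_eq_of_adjoint[OF Bsym, of x] norm_eq_of_adjoint[OF T', of x]
      by (simp add: BB flip: power2_eq_iff_nonneg)
    then show ?thesis by (metis ker norm_eq_zero)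
  qed
  have "(W o\<^sub>L B) - (B o\<^sub>L W) = 0"
  proof (rule zero_on_range_and_kernel[OF Bsym])
    show "((W o\<^sub>L B) - (B o\<^sub>L W)) (B x) = 0" for x
      using blinfun_composeD[OF TB, of x] by (simp add: blinfun.diff_left Tx)
    show "((W o\<^sub>L B) - (B o\<^sub>L W)) x = 0" if "B x = 0" for x
      using that kerB[of x] by (simp add: blinfun.diff_left blinfun.zero_right)
  qed
  then show WB: "W o\<^sub>L B = B o\<^sub>L W" by simp
  have "adjoint_of (W o\<^sub>L B) (B o\<^sub>L W')" "adjoint_of (B o\<^sub>L W) (W' o\<^sub>L B)"
    by (rule adjoint_of_compose[OF W' Bsym] adjoint_of_compose[OF Bsym W'])+
  then show W'B: "W' o\<^sub>L B = B o\<^sub>L W'" unfolding WB using adjoint_of_unique by blast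
  note WBx = blinfun_composeD[OF WB] and W'Bx = blinfun_composeD[OF W'B]
  have kerW': "W' y = 0" if "B y = 0" for y
  proof -
    have "B (W' y) = 0" using that W'Bx[of y] by (simp add: blinfun.zero_right)
    then have "W (W' y) = 0" by (simp add: kerB)
    then have "inner (W' y) (W' y) = 0" using adjoint_ofD[OF W', of "W' y" y] by simp
    then show ?thesis by simp
  qed
  \<comment> \<open>The defect y lies in the kernel of B, which is also the kernel of W, and is a
    difference of elements of the ranges of W' and B; both ranges are orthogonal to that kernel, so
    y = 0.\<close>
  have W'WB: "W' (W (B x)) = B x" for x
  proof -
    define y where "y = W' (W (B x)) - B x"
    have "B y = 0" unfolding y_def using T'x[of "T x"] by (simp add: blinfun.diff_right BB Tx)
    then have "W y = 0" by (simp add: kerB)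
    have "inner y y = inner y (W' (W (B x))) - inner y (B x)" by (simp add: y_def inner_diff)
    also have "\<dots> = 0"
      using adjoint_ofD[OF W', of y "W (B x)"] adjoint_ofD[OF Bsym, of y x] \<open>B y = 0\<close> \<open>W y = 0\<close>
      by simp
    finally show ?thesis by (simp add: y_def)
  qed
  \<comment> \<open>The same argument with W and W' exchanged. Normality enters here: B W W' B = T
    T' = T' T = B^2.\<close>
  have WW'B: "W (W' (B x)) = B x" for x
  proof -
    define y where "y = W (W' (B x)) - B x"
    have "B (W (W' (B x))) = W (B (B (W' x)))" by (simp only: WBx W'Bx)
    also have "\<dots> = T (T' x)" by (simp only: Tx T'x)
    also have "\<dots> = B (B x)" unfolding BB by (rule blinfun_composeD[OF normal, symmetric])
    finally have "B (W (W' (B x))) = B (B x)" .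
    then have "B y = 0" by (simp add: y_def blinfun.diff_right)
    then have "W' y = 0" by (rule kerW')
    have "inner y y = inner y (W (W' (B x))) - inner y (B x)" by (simp add: y_def inner_diff)
    also have "\<dots> = 0"
      using adjoint_ofD[OF adjoint_of_sym[OF W'], of y "W' (B x)"] adjoint_ofD[OF Bsym, of y x]
        \<open>B y = 0\<close> \<open>W' y = 0\<close> by simp
    finally show ?thesis by (simp add: y_def)
  qed
  have "(W' o\<^sub>L W) - (W o\<^sub>L W') = 0"
    by (rule zero_on_range_and_kernel[OF Bsym])
       (auto simp: blinfun.diff_left W'WB WW'B kerW' kerB blinfun.zero_right)
  then show "W' o\<^sub>L W = W o\<^sub>L W'" by simp
  \<comment> \<open>W'W is an idempotent symmetric operator, which yields the contraction bound for
    \<open>W\<close>.\<close>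
  have "(W' o\<^sub>L W o\<^sub>L W' o\<^sub>L W) - (W' o\<^sub>L W) = 0"
    by (rule zero_on_range_and_kernel[OF Bsym])
       (auto simp: blinfun.diff_left W'WB kerB blinfun.zero_right)
  then have proj: "W' (W (W' (W x))) = W' (W x)" for x
    using blinfun_composeD[of "W' o\<^sub>L W o\<^sub>L W'" W W' W x] by simp
  show "norm (W x) \<le> norm x" for x
  proof -
    have 1: "(norm (W x))\<^sup>2 = inner (W' (W x)) x" using norm_eq_of_adjoint[OF W', of x] by simp
    have "(norm (W' (W x)))\<^sup>2 = inner (W (W' (W x))) (W x)"
      using norm_eq_of_adjoint[OF adjoint_of_sym[OF W'], of "W x"] by simp
    also have "\<dots> = inner (W' (W x)) x"
      using adjoint_ofD[OF adjoint_of_sym[OF W'], of "W (W' (W x))" x] by (simp add: proj)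
    finally have "norm (W' (W x)) = norm (W x)" using 1 by (simp flip: power2_eq_iff_nonneg)
    then have "norm (W x) * norm (W x) \<le> norm (W x) * norm x"
      using norm_cauchy_schwarz[of "W' (W x)" x] 1 by (simp add: power2_eq_square)
    then show ?thesis by (cases "norm (W x) = 0") (auto simp: mult_le_cancel_left)
  qed
qed

text \<open>Factor B^2 - \<alpha>^2 I = (B + \<alpha> I)(B - \<alpha> I). For \<alpha> > 0 the first
  factor is bounded below by \<alpha>, so the second is dominated. For \<alpha> = 0, ||B x||^2 is at
  most ||B^2 x|| ||x||, and the tolerance e^2 for B^2 gives e for B.\<close>

lemma ess_zero_sqrt_shift:
  assumes B: "adjoint_of B B" "\<And>x. 0 \<le> inner (blinfun_apply B x) x" and "0 \<le> \<alpha>"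
    and S: "ess_zero ((B o\<^sub>L B) - \<alpha>\<^sup>2 *\<^sub>R id_blinfun)"
  shows "ess_zero (B - \<alpha> *\<^sub>R id_blinfun)"
proof -
  define K where "K = B - \<alpha> *\<^sub>R id_blinfun"
  define S where "S = (B o\<^sub>L B) - \<alpha>\<^sup>2 *\<^sub>R id_blinfun"
  have Sx: "B (K x) + \<alpha> *\<^sub>R K x = S x" for x
    by (simp add: K_def S_def blinfun.bilinear_simps power2_eq_square algebra_simps)
  have S': "ess_zero S" using S by (simp add: S_def)
  show ?thesis
  proof (cases "\<alpha> = 0")
    case False
    with \<open>0 \<le> \<alpha>\<close> have "\<alpha> > 0" by simp
    show ?thesis
      unfolding K_def[symmetric]
    proof (rule ess_zero_dominated[OF S'])
      fix x
      have "\<alpha> * (norm (K x))\<^sup>2 \<le> inner (B (K x)) (K x) + \<alpha> * inner (K x) (K x)"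
        using B(2)[of "K x"] by (simp add: power2_norm_eq_inner)
      also have "\<dots> = inner (S x) (K x)" by (simp add: inner_add_left flip: Sx)
      also have "\<dots> \<le> norm (S x) * norm (K x)" by (rule norm_cauchy_schwarz)
      finally have "(\<alpha> * norm (K x)) * norm (K x) \<le> norm (S x) * norm (K x)"
        by (simp add: power2_eq_square)
      then have "\<alpha> * norm (K x) \<le> norm (S x)"
        by (cases "norm (K x) = 0") (auto simp: mult_le_cancel_right)
      then show "norm (K x) \<le> (1 / \<alpha>) * norm (S x)" using \<open>\<alpha> > 0\<close> by (simp add: field_simps)
    qed
  next
    case True
    have KB: "norm (K x) = norm (B x)" and SB: "S x = B (B x)" for x
      using True by (simp_all add: K_def S_def blinfun.bilinear_simps)
    have "ess_zero K"
      unfolding ess_zero_def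
    proof (intro allI impI)
      fix e :: real assume "e > 0"
      then have "e\<^sup>2 > 0" by simp
      then obtain F where F: "finite F" "\<And>x. x \<in> F\<^sup>\<bottom> \<Longrightarrow> norm (S x) \<le> e\<^sup>2 * norm x"
        using S' unfolding ess_zero_def by meson
      have "norm (K x) \<le> e * norm x" if "x \<in> F\<^sup>\<bottom>" for x
      proof -
        have "(norm (B x))\<^sup>2 = inner (S x) x"
          using norm_eq_of_adjoint[OF B(1), of x] by (simp add: SB)
        also have "\<dots> \<le> norm (S x) * norm x" by (rule norm_cauchy_schwarz)
        also have "\<dots> \<le> (e\<^sup>2 * norm x) * norm x" using F(2)[OF that] by (intro mult_right_mono) auto
        finally have "(norm (B x))\<^sup>2 \<le> (e * norm x)\<^sup>2" by (simp add: power2_eq_square algebra_simps)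
        then have "norm (B x) \<le> e * norm x"
          by (rule power2_le_imp_le) (use \<open>e > 0\<close> in simp)
        then show ?thesis by (simp only: KB)
      qed
      with F(1) show "\<exists>F. finite F \<and> (\<forall>x\<in>F\<^sup>\<bottom>. norm (K x) \<le> e * norm x)" by blast
    qed
    then show ?thesis by (simp add: K_def)
  qed
qed

text \<open>With C = |K|, the parts are N = (C - K)/2 and P = (C + K)/2. They annihilate each other
  because C commutes with K and C^2 = K^2; they are dominated by K because ||C x|| = ||K
  x||.\<close>

lemma positive_negative_parts:
  fixes B :: "'a::{real_inner,banach} \<Rightarrow>\<^sub>L 'a"
  assumes B: "adjoint_of B B" "\<And>x. 0 \<le> inner (blinfun_apply B x) x" and "0 \<le> \<alpha>"
  defines "K \<equiv> B - \<alpha> *\<^sub>R id_blinfun"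
  obtains N P where "adjoint_of N N" "adjoint_of P P" "B = \<alpha> *\<^sub>R id_blinfun - N + P" "N o\<^sub>L P = 0"
    "\<And>x. norm (blinfun_apply N x) \<le> norm (blinfun_apply K x)"
    "\<And>x. norm (blinfun_apply P x) \<le> norm (blinfun_apply K x)"
    "\<And>x. norm (blinfun_apply N x) \<le> \<alpha> * norm x"
    "\<And>S. S o\<^sub>L B = B o\<^sub>L S \<Longrightarrow> S o\<^sub>L N = N o\<^sub>L S" "\<And>S. S o\<^sub>L B = B o\<^sub>L S \<Longrightarrow> S o\<^sub>L P = P o\<^sub>L S"
proof -
  have K: "adjoint_of K K" unfolding K_def by (intro adjoint_of_diff adjoint_of_scaleR adjoint_of_id B)
  obtain C where C: "is_sqrt C (K o\<^sub>L K)"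
    and comm: "\<And>S. S o\<^sub>L (K o\<^sub>L K) = (K o\<^sub>L K) o\<^sub>L S \<Longrightarrow> S o\<^sub>L C = C o\<^sub>L S"
    using sqrt_exists[OF K] by blast
  have Csym: "adjoint_of C C" and Cpos: "\<And>x. 0 \<le> inner (C x) x" and CC: "C (C x) = K (K x)" for x
    using C blinfun_composeD[of C C K K x] by (auto simp: is_sqrt_def)
  have "K o\<^sub>L C = C o\<^sub>L K" by (intro comm blinfun_eqI) simp
  then have KC: "K (C x) = C (K x)" for x by (rule blinfun_composeD)
  have normC: "norm (C x) = norm (K x)" for x
    using norm_eq_of_adjoint[OF Csym, of x] norm_eq_of_adjoint[OF K, of x]
    by (simp add: CC flip: power2_eq_iff_nonneg)
  define N where "N = (1/2) *\<^sub>R (C - K)"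
  define P where "P = (1/2) *\<^sub>R (C + K)"
  have N: "adjoint_of N N" and P: "adjoint_of P P"
    unfolding N_def P_def by (intro adjoint_of_scaleR adjoint_of_diff adjoint_of_add Csym K)+
  have NP: "N (P x) = 0" and PN: "P (N x) = 0" for x
    by (simp_all add: N_def P_def blinfun.bilinear_simps KC CC scaleR_add_right scaleR_diff_right)
  have CNP: "C x = N x + P x" and KNP: "K x = P x - N x" for x
    by (simp_all add: N_def P_def blinfun.bilinear_simps flip: scaleR_add_right scaleR_diff_right)
  have Bx: "B x = \<alpha> *\<^sub>R x - N x + P x" for x
    using KNP[of x] by (simp add: K_def blinfun.bilinear_simps algebra_simps)
  have N_le: "norm (N x) \<le> norm (K x)" and P_le: "norm (P x) \<le> norm (K x)" for x
    using norm_triangle_ineq4[of "C x" "K x"] norm_triangle_ineq[of "C x" "K x"]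
    by (simp_all add: N_def P_def normC blinfun.bilinear_simps)
  \<comment> \<open>On the range of N the operator P vanishes, so there C = N and B = \<alpha> I -
    N. Positivity of C and B puts the form of N between 0 and \<alpha> ||z||^2; the bound then
    passes from the range to all vectors through ||N x||^2 = <N N x, x>.\<close>
  have "norm (N (N x)) \<le> \<alpha> * norm (N x)" for x
  proof (rule symmetric_norm_le[OF N])
    show "subspace (range N)"
      by (rule linear_subspace_image[OF bounded_linear.linear[OF blinfun.bounded_linear_right] subspace_UNIV])
    fix z assume "z \<in> range N"
    then have "P z = 0" using PN by auto
    then have "0 \<le> inner (N z) z" "inner (N z) z \<le> \<alpha> * (norm z)\<^sup>2"
      using Cpos[of z] B(2)[of z]
      by (simp_all add: CNP Bx power2_norm_eq_inner inner_diff_left)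
    then show "\<bar>inner (N z) z\<bar> \<le> \<alpha> * (norm z)\<^sup>2" by simp
  qed auto
  then have "norm (N x) \<le> \<alpha> * norm x" for x
  proof -
    have "(norm (N x))\<^sup>2 = inner (N (N x)) x" using norm_eq_of_adjoint[OF N, of x] by simp
    also have "\<dots> \<le> norm (N (N x)) * norm x" by (rule norm_cauchy_schwarz)
    also have "\<dots> \<le> (\<alpha> * norm (N x)) * norm x"
      using \<open>norm (N (N x)) \<le> \<alpha> * norm (N x)\<close> by (intro mult_right_mono) auto
    finally have "norm (N x) * norm (N x) \<le> norm (N x) * (\<alpha> * norm x)"
      by (simp add: power2_eq_square algebra_simps)
    moreover have "0 \<le> \<alpha> * norm x"
      using \<open>0 \<le> \<alpha>\<close> by simp
    ultimately show ?thesis by (cases "norm (N x) = 0") (auto simp: mult_le_cancel_left)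
  qed
  moreover have "S o\<^sub>L N = N o\<^sub>L S \<and> S o\<^sub>L P = P o\<^sub>L S" if S: "S o\<^sub>L B = B o\<^sub>L S" for S
  proof -
    have SK: "S o\<^sub>L K = K o\<^sub>L S" using S by (simp add: K_def blinfun_compose_simps)
    then have "S (K x) = K (S x)" for x by (rule blinfun_composeD)
    then have "S o\<^sub>L (K o\<^sub>L K) = (K o\<^sub>L K) o\<^sub>L S" by (intro blinfun_eqI) simp
    then have "S o\<^sub>L C = C o\<^sub>L S" by (rule comm)
    with SK show ?thesis by (simp add: N_def P_def blinfun_compose_simps)
  qed
  moreover have "B = \<alpha> *\<^sub>R id_blinfun - N + P" "N o\<^sub>L P = 0"
    by (auto intro!: blinfun_eqI simp: Bx NP blinfun.bilinear_simps)
  ultimately show ?thesis using that[OF N P] N_le P_le by blast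
qed

section \<open>Assembly of the decomposition\<close>

lemma normal_opI:
  assumes "K \<in> BH" "adjoint_of K K'" "K' o\<^sub>L K = K o\<^sub>L K'"
  shows "normal_op K"
  using assms adj_eqI[OF assms(1,2)] by (simp add: normal_op_def)

lemma normal_op_compose_selfadjoint:
  assumes BH: "W o\<^sub>L N \<in> BH" and N: "adjoint_of N N" and W: "adjoint_of W W'" "W' o\<^sub>L W = W o\<^sub>L W'"
    and comm: "W o\<^sub>L N = N o\<^sub>L W" "W' o\<^sub>L N = N o\<^sub>L W'"
  shows "normal_op (W o\<^sub>L N)"
proof (rule normal_opI[OF BH adjoint_of_compose[OF W(1) N]])
  note c = blinfun_composeD[OF comm(1)] blinfun_composeD[OF comm(2)] blinfun_composeD[OF W(2)]
  show "(N o\<^sub>L W') o\<^sub>L (W o\<^sub>L N) = (W o\<^sub>L N) o\<^sub>L (N o\<^sub>L W')"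
    by (rule blinfun_eqI) (simp add: c)
qed

lemma compact_op_of_ess_zero: "K \<in> BH \<Longrightarrow> ess_zero K \<Longrightarrow> compact_op K"
  by (simp add: compact_op_def ess_zero_compact)

lemma op_le_scaled_id:
  assumes K: "K \<in> BH" and le: "\<And>x. norm (blinfun_apply K x) \<le> \<alpha> * norm x"
  shows "op_le (adj K o\<^sub>L K) (\<alpha>\<^sup>2 *\<^sub>R id_blinfun)"
proof -
  note K' = adjoint_of_adj[OF K]
  have A: "adj K o\<^sub>L K \<in> BH" "adjoint_of (adj K o\<^sub>L K) (adj K o\<^sub>L K)"
    by (intro BH_compose BH_adjoint_of[OF K K'] K adjoint_of_compose K' adjoint_of_sym[OF K'])+
  have I: "\<alpha>\<^sup>2 *\<^sub>R id_blinfun \<in> (BH :: ('a \<Rightarrow>\<^sub>L 'a) set)"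
    "adjoint_of (\<alpha>\<^sup>2 *\<^sub>R id_blinfun) (\<alpha>\<^sup>2 *\<^sub>R id_blinfun :: 'a \<Rightarrow>\<^sub>L 'a)"
    by (intro BH_scaleR BH_id adjoint_of_scaleR adjoint_of_id)+
  have "0 \<le> inner ((\<alpha>\<^sup>2 *\<^sub>R id_blinfun - (adj K o\<^sub>L K)) x) x" for x
  proof -
    have "(norm (K x))\<^sup>2 \<le> (\<alpha> * norm x)\<^sup>2" using le[of x] by (intro power_mono) auto
    then show ?thesis
      using norm_eq_of_adjoint[OF K', of x]
      by (simp add: blinfun.bilinear_simps inner_diff_left power_mult_distrib power2_norm_eq_inner)
  qed
  then show ?thesis
    unfolding op_le_def selfadjoint_op_iff positive_op_iff
    using A I BH_diff[OF I(1) A(1)] adjoint_of_diff[OF I(2) A(2)] by blast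
qed

theorem theorem5p3:
  fixes T W :: "'h::chilbert_space \<Rightarrow>\<^sub>L 'h"
  assumes "infinite_dimensional TYPE('h)"
    and "T \<in> closure AN"
    and "normal_op T"
    and "polar_decomposition T W"
  shows "\<exists>(\<alpha>::real) (K\<^sub>1 :: 'h \<Rightarrow>\<^sub>L 'h) (K\<^sub>2 :: 'h \<Rightarrow>\<^sub>L 'h).
    \<alpha> \<ge> 0 \<and> T = \<alpha> *\<^sub>R W - K\<^sub>1 + K\<^sub>2 \<and>
    normal_op K\<^sub>1 \<and> compact_op K\<^sub>1 \<and> normal_op K\<^sub>2 \<and> compact_op K\<^sub>2 \<and>
    K\<^sub>1 o\<^sub>L K\<^sub>2 = 0 \<and> op_le (adj K\<^sub>1 o\<^sub>L K\<^sub>1) (\<alpha>\<^sup>2 *\<^sub>R id_blinfun)"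
proof -
  define B where "B = abs_op T"
  have TBH: "T \<in> BH" and normal: "adj T o\<^sub>L T = T o\<^sub>L adj T"
    using assms(3) by (auto simp: normal_op_def)
  have WBH: "W \<in> BH" and T: "T = W o\<^sub>L B" and ker: "W x = 0 \<longleftrightarrow> T x = 0" for x
    using assms(4) by (auto simp: polar_decomposition_def partial_isometry_def B_def null_space_def)
  note T' = adjoint_of_adj[OF TBH] and W' = adjoint_of_adj[OF WBH]
  note abs = abs_op_properties[OF TBH, folded B_def]
  have Bsym: "adjoint_of B B" and Bpos: "\<And>x. 0 \<le> inner (B x) x" and BB: "B o\<^sub>L B = adj T o\<^sub>L T"
    using abs(2) by (auto simp: is_sqrt_def)
  \<comment> \<open>By normality T commutes with T'T, hence with its square root |T|.\<close>
  have "T o\<^sub>L (adj T o\<^sub>L T) = (adj T o\<^sub>L T) o\<^sub>L T"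
    by (intro blinfun_eqI) (simp only: blinfun_apply_blinfun_compose blinfun_composeD[OF normal, symmetric])
  then have "T o\<^sub>L B = B o\<^sub>L T" by (rule abs(3))
  note polar = polar_factor_normal[OF T' W' abs(2) normal this T ker]

  have "ess_const T" using assms(2) AN_ess_const by (rule ess_const_closure)
  from ess_const_value[OF this] obtain l where l: "l \<ge> 0" "\<And>e. e > 0 \<Longrightarrow> \<exists>F. finite F \<and>
      (\<forall>x\<in>F\<^sup>\<bottom>. \<bar>(norm (T x))\<^sup>2 - l * (norm x)\<^sup>2\<bar> \<le> e * (norm x)\<^sup>2)" by blast
  define \<alpha> where "\<alpha> = sqrt l"
  have \<alpha>: "\<alpha> \<ge> 0" "\<alpha>\<^sup>2 = l" using l(1) by (auto simp: \<alpha>_def)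
  have "ess_zero ((B o\<^sub>L B) - \<alpha>\<^sup>2 *\<^sub>R id_blinfun)"
  proof (rule symmetric_ess_zero)
    show "adjoint_of ((B o\<^sub>L B) - \<alpha>\<^sup>2 *\<^sub>R id_blinfun) ((B o\<^sub>L B) - \<alpha>\<^sup>2 *\<^sub>R id_blinfun)"
      by (intro adjoint_of_diff adjoint_of_compose adjoint_of_scaleR adjoint_of_id Bsym)
    have "inner (((B o\<^sub>L B) - \<alpha>\<^sup>2 *\<^sub>R id_blinfun) x) x = (norm (T x))\<^sup>2 - l * (norm x)\<^sup>2" for x
      unfolding BB using norm_eq_of_adjoint[OF T', of x]
      by (simp add: blinfun.bilinear_simps inner_diff_left power2_norm_eq_inner \<alpha>)
    then show "\<exists>F. finite F \<and>
        (\<forall>x\<in>F\<^sup>\<bottom>. \<bar>inner (((B o\<^sub>L B) - \<alpha>\<^sup>2 *\<^sub>R id_blinfun) x) x\<bar> \<le> e * (norm x)\<^sup>2)" if "e > 0" for e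
      using l(2)[OF that] by simp
  qed
  then have K: "ess_zero (B - \<alpha> *\<^sub>R id_blinfun)"
    by (rule ess_zero_sqrt_shift[OF Bsym Bpos \<alpha>(1)])

  obtain N P where NP: "adjoint_of N N" "adjoint_of P P" "B = \<alpha> *\<^sub>R id_blinfun - N + P" "N o\<^sub>L P = 0"
    and dom: "\<And>x. norm (N x) \<le> norm ((B - \<alpha> *\<^sub>R id_blinfun) x)"
      "\<And>x. norm (P x) \<le> norm ((B - \<alpha> *\<^sub>R id_blinfun) x)"
    and N_le: "\<And>x. norm (N x) \<le> \<alpha> * norm x"
    and comm: "\<And>S. S o\<^sub>L B = B o\<^sub>L S \<Longrightarrow> S o\<^sub>L N = N o\<^sub>L S" "\<And>S. S o\<^sub>L B = B o\<^sub>L S \<Longrightarrow> S o\<^sub>L P = P o\<^sub>L S"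
    using positive_negative_parts[OF Bsym Bpos \<alpha>(1)] by blast
  \<comment> \<open>Scalar multiplications commute with |T| and therefore with both parts.\<close>
  have "N \<in> BH" "P \<in> BH"
    using abs(1) comm unfolding BH_iff_commute by blast+
  then have BH: "W o\<^sub>L N \<in> BH" "W o\<^sub>L P \<in> BH" by (auto intro: BH_compose WBH)
  show ?thesis
  proof (intro exI conjI)
    show "\<alpha> \<ge> 0" by fact
    \<comment> \<open>The witnesses come from multiplying |T| = \<alpha> I - N + P by W on the
      left.\<close>
    show "T = \<alpha> *\<^sub>R W - (W o\<^sub>L N) + (W o\<^sub>L P)"
      by (subst T, subst NP(3)) (simp add: blinfun_compose_simps)
    show "normal_op (W o\<^sub>L N)" "normal_op (W o\<^sub>L P)"
      using normal_op_compose_selfadjoint[OF _ _ W' polar(3)] BH NP(1,2)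
        comm(1)[OF polar(1)] comm(1)[OF polar(2)] comm(2)[OF polar(1)] comm(2)[OF polar(2)] by blast+
    have "ess_zero (W o\<^sub>L N)" "ess_zero (W o\<^sub>L P)"
      using order_trans[OF polar(4) dom(1)] order_trans[OF polar(4) dom(2)]
      by (auto intro!: ess_zero_dominated[OF K, where c = 1])
    with BH show "compact_op (W o\<^sub>L N)" "compact_op (W o\<^sub>L P)"
      by (auto intro: compact_op_of_ess_zero)
    show "(W o\<^sub>L N) o\<^sub>L (W o\<^sub>L P) = 0"
    proof (rule blinfun_eqI)
      fix x
      \<comment> \<open>W commutes with N because it commutes with |T|; this brings N next to
        P.\<close>
      have "N (W (P x)) = W (N (P x))" using blinfun_composeD[OF comm(1)[OF polar(1)]] by simp
      also have "\<dots> = 0" using arg_cong[OF NP(4), of "\<lambda>U. U x"] by (simp add: blinfun.zero_right)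
      finally show "((W o\<^sub>L N) o\<^sub>L (W o\<^sub>L P)) x = blinfun_apply 0 x" by (simp add: blinfun.zero_right)
    qed
    show "op_le (adj (W o\<^sub>L N) o\<^sub>L (W o\<^sub>L N)) (\<alpha>\<^sup>2 *\<^sub>R id_blinfun)"
      using order_trans[OF polar(4) N_le] by (intro op_le_scaled_id BH) simp
  qed
qed

end
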